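(* Let $H$ be a separable real Hilbert space with norm $\|\cdot\|$ and inner product $\langle\cdot,\cdot\rangle$. Let $(Y,X)$ be a random pair with values in $H\times\mathbb{R}$, where $X$ has a probability density $p$, and for $x$ in the support of $p$ let $\mu_x$ denote the conditional law of $Y$ given $X=x$. Let $(X_n,Y_n)_{n\ge1}$ be independent copies of $(X,Y)$, let $K:\mathbb{R}\to\mathbb{R}$ be a kernel, and let $(\gamma_n)_{n\ge1}$, $(h_n)_{n\ge1}$ be deterministic sequences of positive numbers. For a fixed $x\in\mathbb{R}$ and a given initial point $Z_1(x)\in H$, define recursively $$Z_{n+1}(x)=Z_n(x)+\gamma_n\,\frac{Y_{n+1}-Z_n(x)}{\|Y_{n+1}-Z_n(x)\|}\,\frac{1}{h_n}K\!\left(\frac{X_{n+1}-x}{h_n}\right),\qquad n\ge1.$$ Let $m(x)$ be the conditional geometric median of $Y$ given $X=x$, i.e. the minimizer over $\alpha\in H$ of $G(\alpha,x)=p(x)\,\mathbb{E}\big[\|Y-\alpha\|-\|Y\|\,\big|\,X=x\big]$, and let $\Phi(x,\alpha)=-p(x)\,\mathbb{E}\big[\frac{Y-\alpha}{\|Y-\alpha\|}\,\big|\,X=x\big]$. Assume: (A1) for every $x$ in the support of $p$ and every $v\in H$ there exists $w\in H$ with $\langle v,w\rangle=0$ and $\mathrm{Var}(\langle w,Y\rangle\mid X=x)>0$; (A2) $p$ is bounded and there are constants $\beta>0$, $C_2>0$ with $|p(x)-p(x')|\le C_2|x-x'|^\beta$ for all $x,x'\in\mathbb{R}$; (A3) there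 is $C_3>0$ such that $\|\Phi(x,\alpha)-\Phi(x',\alpha)\|\le C_3|x-x'|^\beta$ for all $x,x'\in\mathbb{R}$ and all $\alpha\in H$ (with the same $\beta$ as in (A2)); (A5) $K$ is nonnegative, bounded, has compact support and $\int_{\mathbb{R}}K(u)\,du=1$. If moreover $\sum_n\gamma_n=\infty$, $\sum_n\gamma_n^2h_n^{-1}<\infty$ and $\sum_n\gamma_nh_n^\beta<\infty$, then for every $x$ with $p(x)>0$, $$\lim_{n\to\infty}\|Z_n(x)-m(x)\|=0\quad\text{almost surely.}$$
   Context: Under (A1) the minimizer $m(x)$ of $G(\cdot,x)$ exists and is unique whenever $p(x)>0$. The conditional expectations are taken with respect to the conditional law $\mu_x$. *)

theory Defs
  imports "HOL-Probability.Probability"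
begin

text \<open>Conditional-law objects. The conditional law of Y given X = x is a
Markov kernel mu :: real => 'h measure.\<close>

definition cgm_G :: "(real \<Rightarrow> real) \<Rightarrow> (real \<Rightarrow> 'h::{real_inner,banach,second_countable_topology} measure)
    \<Rightarrow> 'h \<Rightarrow> real \<Rightarrow> real" where
  "cgm_G p mu \<alpha> x = p x * (\<integral>y. norm (y - \<alpha>) - norm y \<partial>mu x)"

definition cgm_Phi :: "(real \<Rightarrow> real) \<Rightarrow> (real \<Rightarrow> 'h::{real_inner,banach,second_countable_topology} measure)
    \<Rightarrow> real \<Rightarrow> 'h \<Rightarrow> 'h" where
  "cgm_Phi p mu x \<alpha> = - (p x *\<^sub>R (\<integral>y. (1 / norm (y - \<alpha>)) *\<^sub>R (y - \<alpha>) \<partial>mu x))"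

text \<open>Conditional variance of a real function f under the law Q, in the extended
sense: the nonnegative integral of (f - E f)^2 (equals +infinity when f is not
square integrable).\<close>
definition ext_variance :: "'a measure \<Rightarrow> ('a \<Rightarrow> real) \<Rightarrow> ennreal" where
  "ext_variance Q f = (\<integral>\<^sup>+y. ennreal ((f y - (\<integral>z. f z \<partial>Q))\<^sup>2) \<partial>Q)"

end

theory Submission
  imports Defs
begin

text \<open>
  The squared error \<open>V n = |Z n - m|\<^sup>2\<close> is a Lyapunov function. One step of the recursion changes it by a
  martingale difference, a square of expected size \<open>O(\<gamma>\<^sup>2 / h)\<close>, and a drift which, by the
  smoothness of \<open>\<Phi>\<close> and the subgradient inequality for the norm, is at most
  \<open>-2 \<gamma> (G(Z n) - G(m)) + O(\<gamma> h\<^sup>\<beta>) (1 + V n)\<close>. Hence \<open>E V n\<close> stays bounded, the martingale part is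
  bounded in \<open>L\<^sup>2\<close> and therefore converges almost surely, so \<open>V n\<close> converges and
  \<open>\<Sum> \<gamma> (G(Z n) - G(m))\<close> is finite. As \<open>\<Sum> \<gamma>\<close> diverges, a nonzero limit of \<open>V n\<close> would contradict the
  fact that \<open>G - G(m)\<close> is bounded away from zero on every annulus around \<open>m\<close>.
\<close>

section \<open>Almost sure convergence of square-summable martingale differences\<close>

text \<open>No conditional expectation operator occurs. The mean increment given the past is a
  deterministic function \<open>drift n\<close> of a frozen position, evaluated at the current
  iterate, and the martingale property is stated as orthogonality to all bounded functions of the
  past.

  The obstacle is the lack of a bound on the iterates that is uniform in \<open>n\<close>. Since the
  direction is normalized and the kernel bounded, each \<open>Z n\<close> is bounded for fixed
  \<open>n\<close>; this settles all questions of integrability, but the bounds may grow with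
  \<open>n\<close>. The uniform estimates are in mean square. One of the two kernel factors in a
  square is bounded by a constant over \<open>h\<close>, while the other integrates to one, hence
  the rate \<open>\<gamma>\<^sup>2 / h\<close>. The martingale differences have the same rate, but
  multiplied by the mean of \<open>V n\<close>, so a Gronwall bound on that mean has to come first.

  Assumption (A1) is qualitative and gives no modulus of convexity. The separation constant
  therefore depends on the annulus in an unspecified way, which is enough for convergence without a
  rate.\<close>

lemma AE_summable_nonneg:
  fixes f :: "nat \<Rightarrow> 'a \<Rightarrow> real"
  assumes int: "\<And>n. integrable M (f n)" and nonneg: "\<And>n \<omega>. \<omega> \<in> space M \<Longrightarrow> 0 \<le> f n \<omega>"
    and le: "\<And>n. (\<integral>\<omega>. f n \<omega> \<partial>M) \<le> b n" and b: "summable b"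
  shows "AE \<omega> in M. summable (\<lambda>n. f n \<omega>)"
proof -
  have [measurable]: "f n \<in> borel_measurable M" for n using int by blast
  have b0: "0 \<le> b n" for n
    using order_trans[OF Bochner_Integration.integral_nonneg le[of n]] nonneg by blast
  have "(\<integral>\<^sup>+\<omega>. (\<Sum>n. ennreal (f n \<omega>)) \<partial>M) = (\<Sum>n. \<integral>\<^sup>+\<omega>. ennreal (f n \<omega>) \<partial>M)"
    by (rule nn_integral_suminf) measurable
  also have "\<dots> = (\<Sum>n. ennreal (\<integral>\<omega>. f n \<omega> \<partial>M))"
    using nonneg by (intro suminf_cong nn_integral_eq_integral int) auto
  also have "\<dots> \<le> (\<Sum>n. ennreal (b n))"
    using le by (intro suminf_le) (auto intro: ennreal_leI)
  also have "\<dots> < \<infinity>"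
    using b b0 by (simp add: suminf_ennreal2)
  finally have "AE \<omega> in M. (\<Sum>n. ennreal (f n \<omega>)) \<noteq> \<infinity>"
    by (intro nn_integral_noteq_infinite) auto
  then show ?thesis
    by (rule AE_mp) (auto intro!: AE_I2 summable_suminf_not_top nonneg)
qed

text \<open>Testing against bounded \<open>F n\<close>-measurable functions expresses that
  \<open>D n\<close> has conditional mean zero. The bounds on \<open>D n\<close> may depend on
  \<open>n\<close>: they serve integrability only and enter no estimate. The index is shifted, as
  \<open>D n\<close> is revealed at time \<open>Suc n\<close>.\<close>

locale bounded_martingale_differences = prob_space M for M :: "'a measure" +
  fixes F :: "nat \<Rightarrow> 'a measure" and D :: "nat \<Rightarrow> 'a \<Rightarrow> real"
  assumes subalg: "\<And>n. subalgebra M (F n)"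
    and filtration: "\<And>i j. i \<le> j \<Longrightarrow> sets (F i) \<subseteq> sets (F j)"
    and D_adapted: "\<And>n. D n \<in> borel_measurable (F (Suc n))"
    and D_bounded: "\<And>n. \<exists>B. \<forall>\<omega>\<in>space M. \<bar>D n \<omega>\<bar> \<le> B"
    and D_orthogonal: "\<And>n g B. g \<in> borel_measurable (F n) \<Longrightarrow> (\<And>\<omega>. \<omega> \<in> space M \<Longrightarrow> \<bar>g \<omega>\<bar> \<le> B) \<Longrightarrow>
      expectation (\<lambda>\<omega>. g \<omega> * D n \<omega>) = 0"
begin

lemma measurable_mono: "i \<le> j \<Longrightarrow> f \<in> borel_measurable (F i) \<Longrightarrow> f \<in> borel_measurable (F j)"
  using subalg[of i] subalg[of j] filtration[of i j]
  by (auto simp: measurable_def subalgebra_def)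

lemma measurable_M: "f \<in> borel_measurable (F i) \<Longrightarrow> f \<in> borel_measurable M"
  using measurable_from_subalg[OF subalg] by blast

lemma integrable_bdd:
  fixes f :: "'a \<Rightarrow> real"
  assumes "f \<in> borel_measurable M" "\<And>\<omega>. \<omega> \<in> space M \<Longrightarrow> \<bar>f \<omega>\<bar> \<le> B"
  shows "integrable M f"
  using assms by (intro integrable_const_bound[of _ B]) auto

lemma integrable_square_bdd:
  fixes f :: "'a \<Rightarrow> real"
  assumes "f \<in> borel_measurable M" and B: "\<And>\<omega>. \<omega> \<in> space M \<Longrightarrow> \<bar>f \<omega>\<bar> \<le> B"
  shows "integrable M (\<lambda>\<omega>. (f \<omega>)\<^sup>2)"
proof (rule integrable_bdd[of _ "B\<^sup>2"])
  show "\<bar>(f \<omega>)\<^sup>2\<bar> \<le> B\<^sup>2" if "\<omega> \<in> space M" for \<omega>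
    using power_mono[OF B[OF that], of 2] by simp
qed (use assms(1) in measurable)

text \<open>Lets the maximal inequality be applied to the increments \<open>S (n + i) - S n\<close>
  of the partial sums.\<close>

lemma shift: "bounded_martingale_differences M (\<lambda>n. F (k + n)) (\<lambda>n. D (k + n))"
proof unfold_locales
  show "subalgebra M (F (k + n))" for n by (rule subalg)
  show "sets (F (k + i)) \<subseteq> sets (F (k + j))" if "i \<le> j" for i j
    using that by (intro filtration) auto
  show "D (k + n) \<in> borel_measurable (F (k + Suc n))" for n using D_adapted[of "k+n"] by simp
  show "\<exists>B. \<forall>\<omega>\<in>space M. \<bar>D (k + n) \<omega>\<bar> \<le> B" for n by (rule D_bounded)
qed (use D_orthogonal in blast)

lemma adapted_sum:
  assumes "\<And>k. k < n \<Longrightarrow> c k \<in> borel_measurable (F k)"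
  shows "(\<lambda>\<omega>. \<Sum>k<n. c k \<omega> * D k \<omega>) \<in> borel_measurable (F n)"
proof (intro borel_measurable_sum borel_measurable_times)
  fix k assume k: "k \<in> {..<n}"
  then show "c k \<in> borel_measurable (F n)" "D k \<in> borel_measurable (F n)"
    using assms[of k] D_adapted[of k] measurable_mono[of k n] measurable_mono[of "Suc k" n] by auto
qed

lemma bounded_sum:
  assumes "\<And>k \<omega>. k < n \<Longrightarrow> \<omega> \<in> space M \<Longrightarrow> \<bar>c k \<omega>\<bar> \<le> 1"
  shows "\<exists>B. \<forall>\<omega>\<in>space M. \<bar>\<Sum>k<n. c k \<omega> * D k \<omega>\<bar> \<le> B"
proof -
  obtain B where B: "\<And>n \<omega>. \<omega> \<in> space M \<Longrightarrow> \<bar>D n \<omega>\<bar> \<le> B n" using D_bounded by metis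
  have "\<bar>\<Sum>k<n. c k \<omega> * D k \<omega>\<bar> \<le> (\<Sum>k<n. B k)" if w: "\<omega> \<in> space M" for \<omega>
  proof -
    have "\<bar>c k \<omega> * D k \<omega>\<bar> \<le> B k" if "k < n" for k
      using mult_mono[of "\<bar>c k \<omega>\<bar>" 1 "\<bar>D k \<omega>\<bar>" "B k"] assms[OF that w] B[OF w, of k]
      by (simp add: abs_mult)
    then show ?thesis by (intro order_trans[OF sum_abs] sum_mono) auto
  qed
  then show ?thesis by blast
qed

text \<open>Expanding the square of the next sum, the cross term is \<open>D n\<close> times a
  bounded \<open>F n\<close>-measurable function and has mean zero; the new square only shrinks
  under a coefficient of modulus at most one.\<close>

lemma transform_second_moment:
  assumes c: "\<And>k. c k \<in> borel_measurable (F k)" and c1: "\<And>k \<omega>. \<bar>c k \<omega>\<bar> \<le> 1"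
  shows "expectation (\<lambda>\<omega>. (\<Sum>k<n. c k \<omega> * D k \<omega>)\<^sup>2) \<le> (\<Sum>k<n. expectation (\<lambda>\<omega>. (D k \<omega>)\<^sup>2))"
proof (induction n)
  case 0 then show ?case by simp
next
  case (Suc n)
  define U where "U \<omega> = (\<Sum>k<n. c k \<omega> * D k \<omega>)" for \<omega>
  have UF: "U \<in> borel_measurable (F n)" unfolding U_def by (rule adapted_sum[OF c])
  obtain B where B: "\<And>\<omega>. \<omega> \<in> space M \<Longrightarrow> \<bar>U \<omega>\<bar> \<le> B"
    using bounded_sum[of n c] c1 unfolding U_def by blast
  obtain b where b: "\<And>\<omega>. \<omega> \<in> space M \<Longrightarrow> \<bar>D n \<omega>\<bar> \<le> b" using D_bounded by metis
  have [measurable]: "U \<in> borel_measurable M" "c n \<in> borel_measurable M" "D n \<in> borel_measurable M"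
    using UF c D_adapted measurable_M by blast+
  have Uc: "\<bar>2 * U \<omega> * c n \<omega>\<bar> \<le> 2 * B" if "\<omega> \<in> space M" for \<omega>
    using mult_mono[OF B[OF that] c1[of n \<omega>]] B[OF that] by (simp add: abs_mult)
  have z: "expectation (\<lambda>\<omega>. (2 * U \<omega> * c n \<omega>) * D n \<omega>) = 0"
    by (rule D_orthogonal[OF _ Uc]) (use UF c in measurable)
  have i1: "integrable M (\<lambda>\<omega>. (U \<omega>)\<^sup>2)"
    by (rule integrable_square_bdd[OF _ B]) simp_all
  have i2: "integrable M (\<lambda>\<omega>. (2 * U \<omega> * c n \<omega>) * D n \<omega>)"
  proof (rule integrable_bdd[of _ "2 * B * b"])
    show "\<bar>2 * U \<omega> * c n \<omega> * D n \<omega>\<bar> \<le> 2 * B * b" if "\<omega> \<in> space M" for \<omega>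
      using mult_mono[OF Uc[OF that] b[OF that]] B[OF that] by (simp add: abs_mult)
  qed measurable
  have cb: "(c n \<omega> * D n \<omega>)\<^sup>2 \<le> (D n \<omega>)\<^sup>2" for \<omega>
    using mult_mono[OF c1[of n \<omega>], of "\<bar>D n \<omega>\<bar>" "\<bar>D n \<omega>\<bar>"] by (simp add: abs_le_square_iff[symmetric] abs_mult)
  have i4: "integrable M (\<lambda>\<omega>. (D n \<omega>)\<^sup>2)"
    by (rule integrable_square_bdd[OF _ b]) simp_all
  have i3: "integrable M (\<lambda>\<omega>. (c n \<omega> * D n \<omega>)\<^sup>2)"
    by (rule Bochner_Integration.integrable_bound[OF i4]) (use cb in auto)
  have "expectation (\<lambda>\<omega>. (\<Sum>k<Suc n. c k \<omega> * D k \<omega>)\<^sup>2)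
    = expectation (\<lambda>\<omega>. (U \<omega>)\<^sup>2 + (2 * U \<omega> * c n \<omega>) * D n \<omega> + (c n \<omega> * D n \<omega>)\<^sup>2)"
    by (simp add: U_def power2_eq_square algebra_simps)
  also have "\<dots> = expectation (\<lambda>\<omega>. (U \<omega>)\<^sup>2) + expectation (\<lambda>\<omega>. (c n \<omega> * D n \<omega>)\<^sup>2)"
    using z i1 i2 i3 by simp
  also have "\<dots> \<le> (\<Sum>k<n. expectation (\<lambda>\<omega>. (D k \<omega>)\<^sup>2)) + expectation (\<lambda>\<omega>. (D n \<omega>)\<^sup>2)"
    using Suc i3 i4 cb by (intro add_mono integral_mono) (auto simp: U_def)
  finally show ?case by simp
qed

text \<open>The maximum is controlled by stopping the sum when it first leaves \<open>(-l, l)\<close>: the stopped sum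
  is a transform of \<open>D\<close> and stays at distance at least \<open>l\<close> from the origin afterwards.\<close>

lemma maximal_inequality_finite:
  assumes l: "l > 0"
  shows "l\<^sup>2 * prob {\<omega>\<in>space M. \<exists>i\<le>n. \<bar>\<Sum>k<i. D k \<omega>\<bar> \<ge> l} \<le> (\<Sum>k<n. expectation (\<lambda>\<omega>. (D k \<omega>)\<^sup>2))"
proof -
  define S where "S i \<omega> = (\<Sum>k<i. D k \<omega>)" for i \<omega>
  define c where "c k \<omega> = (of_bool (\<forall>i\<le>k. \<bar>S i \<omega>\<bar> < l) :: real)" for k \<omega>
  define U where "U n \<omega> = (\<Sum>k<n. c k \<omega> * D k \<omega>)" for n \<omega>
  have SF: "S i \<in> borel_measurable (F k)" if "i \<le> k" for i k
    using adapted_sum[of i "\<lambda>_ _. 1"] measurable_mono[OF that] unfolding S_def by simp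
  have cF: "c k \<in> borel_measurable (F k)" for k
  proof -
    have "Measurable.pred (F k) (\<lambda>\<omega>. \<bar>S i \<omega>\<bar> < l)" if "i \<le> k" for i
      by (rule borel_measurable_pred_less) (use SF[OF that] in auto)
    then have "Measurable.pred (F k) (\<lambda>\<omega>. \<forall>i\<in>{..k}. \<bar>S i \<omega>\<bar> < l)"
      by (intro pred_intros_finite) auto
    then have "(\<lambda>\<omega>. if \<forall>i\<in>{..k}. \<bar>S i \<omega>\<bar> < l then 1 else 0 :: real) \<in> borel_measurable (F k)"
      by (intro measurable_If predE) auto
    moreover have "c k = (\<lambda>\<omega>. if \<forall>i\<in>{..k}. \<bar>S i \<omega>\<bar> < l then 1 else 0)"
      by (auto simp: c_def fun_eq_iff)
    ultimately show ?thesis by metis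
  qed
  \<comment> \<open>The two halves overlap at the exit time: the coefficients in \<open>U n\<close>
    look at \<open>S i\<close> only for \<open>i < n\<close>, so \<open>U n\<close> still equals
    \<open>S n\<close> when \<open>S n\<close> is the first sum outside the band, and it is frozen
    from then on.\<close>
  have stop: "((\<forall>i<n. \<bar>S i \<omega>\<bar> < l) \<longrightarrow> U n \<omega> = S n \<omega>) \<and> ((\<exists>i\<le>n. \<bar>S i \<omega>\<bar> \<ge> l) \<longrightarrow> \<bar>U n \<omega>\<bar> \<ge> l)" for n \<omega>
  proof (induction n)
    case 0 then show ?case by (simp add: U_def S_def)
  next
    case (Suc n)
    have Us: "U (Suc n) \<omega> = U n \<omega> + c n \<omega> * D n \<omega>" "S (Suc n) \<omega> = S n \<omega> + D n \<omega>"
      by (simp_all add: U_def S_def)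
    show ?case
    proof (cases "\<forall>i\<le>n. \<bar>S i \<omega>\<bar> < l")
      case True
      then have "U (Suc n) \<omega> = S (Suc n) \<omega>" using Us Suc by (simp add: c_def)
      with True show ?thesis by (metis le_SucE not_le)
    next
      case False
      then have "c n \<omega> = 0" by (simp add: c_def)
      moreover have "\<bar>U n \<omega>\<bar> \<ge> l" using Suc False by (auto simp: not_less)
      moreover have "\<not> (\<forall>i<Suc n. \<bar>S i \<omega>\<bar> < l)" using False by (auto simp: less_Suc_eq_le)
      ultimately show ?thesis using Us(1) by auto
    qed
  qed
  have UM [measurable]: "U n \<in> borel_measurable M"
    unfolding U_def by (rule measurable_M[OF adapted_sum[OF cF]])
  have [measurable]: "S i \<in> borel_measurable M" for i using measurable_M SF by blast
  obtain B where B: "\<And>\<omega>. \<omega> \<in> space M \<Longrightarrow> \<bar>U n \<omega>\<bar> \<le> B"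
    using bounded_sum[of n c] unfolding U_def c_def by fastforce
  have iU: "integrable M (\<lambda>\<omega>. (U n \<omega>)\<^sup>2)"
    by (rule integrable_square_bdd[OF _ B]) simp_all
  have "prob {\<omega>\<in>space M. \<exists>i\<le>n. \<bar>S i \<omega>\<bar> \<ge> l} \<le> prob {\<omega>\<in>space M. l\<^sup>2 \<le> (U n \<omega>)\<^sup>2}"
  proof (rule finite_measure_mono)
    show "{\<omega>\<in>space M. \<exists>i\<le>n. \<bar>S i \<omega>\<bar> \<ge> l} \<subseteq> {\<omega>\<in>space M. l\<^sup>2 \<le> (U n \<omega>)\<^sup>2}"
      using stop[of n] l by (auto simp: abs_le_square_iff[symmetric])
  qed measurable
  also have "\<dots> \<le> expectation (\<lambda>\<omega>. (U n \<omega>)\<^sup>2) / l\<^sup>2"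
    using integral_Markov_inequality_measure[OF iU, of "{}" "l\<^sup>2"] l by simp
  also have "\<dots> \<le> (\<Sum>k<n. expectation (\<lambda>\<omega>. (D k \<omega>)\<^sup>2)) / l\<^sup>2"
    unfolding U_def by (intro divide_right_mono transform_second_moment cF) (auto simp: c_def)
  finally show ?thesis using l unfolding S_def by (simp add: field_simps)
qed

lemma maximal_inequality:
  assumes l: "l > 0" and s: "summable (\<lambda>k. expectation (\<lambda>\<omega>. (D k \<omega>)\<^sup>2))"
  shows "l\<^sup>2 * prob {\<omega>\<in>space M. \<exists>i. \<bar>\<Sum>k<i. D k \<omega>\<bar> \<ge> l} \<le> (\<Sum>k. expectation (\<lambda>\<omega>. (D k \<omega>)\<^sup>2))"
proof -
  define A where "A n = {\<omega>\<in>space M. \<exists>i\<le>n. \<bar>\<Sum>k<i. D k \<omega>\<bar> \<ge> l}" for n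
  have [measurable]: "D k \<in> borel_measurable M" for k using D_adapted measurable_M by blast
  have "(\<lambda>n. prob (A n)) \<longlonglongrightarrow> prob (\<Union>n. A n)"
    by (rule finite_Lim_measure_incseq) (auto simp: A_def incseq_def intro: order_trans)
  then have "(\<lambda>n. l\<^sup>2 * prob (A n)) \<longlonglongrightarrow> l\<^sup>2 * prob (\<Union>n. A n)"
    by (rule tendsto_mult_left)
  moreover have "l\<^sup>2 * prob (A n) \<le> (\<Sum>k. expectation (\<lambda>\<omega>. (D k \<omega>)\<^sup>2))" for n
    using maximal_inequality_finite[OF l, of n] sum_le_suminf[OF s, of "{..<n}"]
    unfolding A_def by fastforce
  ultimately have "l\<^sup>2 * prob (\<Union>n. A n) \<le> (\<Sum>k. expectation (\<lambda>\<omega>. (D k \<omega>)\<^sup>2))"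
    by (intro LIMSEQ_le_const2) auto
  moreover have "(\<Union>n. A n) = {\<omega>\<in>space M. \<exists>i. \<bar>\<Sum>k<i. D k \<omega>\<bar> \<ge> l}"
    by (auto simp: A_def)
  ultimately show ?thesis by simp
qed

theorem AE_summable:
  assumes s: "summable (\<lambda>k. expectation (\<lambda>\<omega>. (D k \<omega>)\<^sup>2))"
  shows "AE \<omega> in M. summable (\<lambda>k. D k \<omega>)"
proof -
  define S where "S i \<omega> = (\<Sum>k<i. D k \<omega>)" for i \<omega>
  have Dm [measurable]: "D k \<in> borel_measurable M" for k using D_adapted measurable_M by blast
  have [measurable]: "S k \<in> borel_measurable M" for k unfolding S_def by measurable
  have tail: "AE \<omega> in M. \<exists>n. \<forall>i. \<bar>S (n + i) \<omega> - S n \<omega>\<bar> < l" if l: "l > 0" for l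
  proof -
    \<comment> \<open>On \<open>N\<close> the partial sums move again by at least \<open>l\<close>
      after every index. The maximal inequality for the shifted sequence bounds
      \<open>l\<^sup>2 * prob N\<close> by every tail of the convergent series of second moments, so
      \<open>N\<close> is null.\<close>
    define N where "N = {\<omega>\<in>space M. \<forall>n. \<exists>i. l \<le> \<bar>S (n + i) \<omega> - S n \<omega>\<bar>}"
    have [measurable]: "N \<in> sets M" unfolding N_def by measurable
    have shifted: "S (n + i) \<omega> - S n \<omega> = (\<Sum>k<i. D (n + k) \<omega>)" for n i \<omega>
      unfolding S_def by (induction i) (simp_all add: algebra_simps)
    have "l\<^sup>2 * prob N \<le> (\<Sum>k. expectation (\<lambda>\<omega>. (D (n + k) \<omega>)\<^sup>2))" for n
    proof -
      interpret sh: bounded_martingale_differences M "\<lambda>k. F (n + k)" "\<lambda>k. D (n + k)" by (rule shift)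
      have "prob N \<le> prob {\<omega>\<in>space M. \<exists>i. \<bar>\<Sum>k<i. D (n + k) \<omega>\<bar> \<ge> l}"
        by (rule finite_measure_mono) (auto simp: N_def shifted)
      moreover have "summable (\<lambda>k. expectation (\<lambda>\<omega>. (D (n + k) \<omega>)\<^sup>2))"
        using summable_ignore_initial_segment[OF s, of n] by (simp add: add.commute)
      ultimately show ?thesis
        using sh.maximal_inequality[OF l] mult_left_mono[of "prob N" _ "l\<^sup>2"] by fastforce
    qed
    moreover have "(\<lambda>n. \<Sum>k. expectation (\<lambda>\<omega>. (D (n + k) \<omega>)\<^sup>2)) \<longlonglongrightarrow> 0"
      using suminf_exist_split2[OF s] by (simp add: add.commute)
    ultimately have "l\<^sup>2 * prob N \<le> 0"
      by (intro LIMSEQ_le_const) auto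
    then have "prob N = 0" using l by (simp add: mult_le_0_iff measure_le_0_iff)
    then have "AE \<omega> in M. \<omega> \<notin> N" by (subst (asm) prob_eq_0) auto
    then show ?thesis by (rule AE_mp) (auto simp: N_def not_le intro!: AE_I2)
  qed
  \<comment> \<open>Countably many levels are enough for the Cauchy property, and only countably
    many null sets may be united.\<close>
  have "AE \<omega> in M. \<forall>j. \<exists>n. \<forall>i. \<bar>S (n + i) \<omega> - S n \<omega>\<bar> < inverse (real (Suc j))"
    by (subst AE_all_countable) (auto intro!: tail)
  then show ?thesis
  proof (rule AE_mp, intro AE_I2 impI)
    fix \<omega> assume *: "\<forall>j. \<exists>n. \<forall>i. \<bar>S (n + i) \<omega> - S n \<omega>\<bar> < inverse (real (Suc j))"
    have "Cauchy (\<lambda>n. S n \<omega>)"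
    proof (rule metric_CauchyI)
      fix e :: real assume "e > 0"
      then obtain j where j: "inverse (real (Suc j)) < e / 2" using reals_Archimedean[of "e/2"] by auto
      obtain n where n: "\<And>i. \<bar>S (n + i) \<omega> - S n \<omega>\<bar> < inverse (real (Suc j))" using * by blast
      have "dist (S a \<omega>) (S b \<omega>) < e" if "a \<ge> n" "b \<ge> n" for a b
        using n[of "a - n"] n[of "b - n"] that j by (simp add: dist_real_def)
      then show "\<exists>N. \<forall>a\<ge>N. \<forall>b\<ge>N. dist (S a \<omega>) (S b \<omega>) < e" by blast
    qed
    then show "summable (\<lambda>k. D k \<omega>)"
      unfolding summable_iff_convergent S_def by (simp add: Cauchy_convergent_iff)
  qed
qed

subsection \<open>A Robbins-Siegmund lemma\<close>

text \<open>The decomposition is pathwise: \<open>D\<close> is the martingale part, \<open>R\<close>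
  a nonnegative error with summable mean, and \<open>e\<close> a drift controlled from above only.
  Since the second moment of \<open>D n\<close> may grow with the mean of \<open>V n\<close>, that
  mean is bounded first, and only then is the series of \<open>D\<close> summed.\<close>

theorem Robbins_Siegmund:
  fixes V R e g :: "nat \<Rightarrow> 'a \<Rightarrow> real" and a b c :: "nat \<Rightarrow> real"
  assumes V_int: "\<And>n. integrable M (V n)" and V_nonneg: "\<And>n \<omega>. \<omega> \<in> space M \<Longrightarrow> 0 \<le> V n \<omega>"
    and R_int: "\<And>n. integrable M (R n)" and R_nonneg: "\<And>n \<omega>. \<omega> \<in> space M \<Longrightarrow> 0 \<le> R n \<omega>"
    and R_le: "\<And>n. expectation (R n) \<le> b n"
    and rec: "\<And>n \<omega>. \<omega> \<in> space M \<Longrightarrow> V (Suc n) \<omega> = V n \<omega> + D n \<omega> + R n \<omega> + e n \<omega>"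
    and e_le: "\<And>n \<omega>. \<omega> \<in> space M \<Longrightarrow> e n \<omega> \<le> a n * (1 + V n \<omega>) - g n \<omega>"
    and g_nonneg: "\<And>n \<omega>. \<omega> \<in> space M \<Longrightarrow> 0 \<le> g n \<omega>"
    and D_le: "\<And>n. expectation (\<lambda>\<omega>. (D n \<omega>)\<^sup>2) \<le> c n * (1 + expectation (V n))"
    and a_nonneg: "\<And>n. 0 \<le> a n" and c_nonneg: "\<And>n. 0 \<le> c n"
    and sa: "summable a" and sb: "summable b" and sc: "summable c"
  shows "AE \<omega> in M. convergent (\<lambda>n. V n \<omega>) \<and> summable (\<lambda>n. g n \<omega>)"
proof -
  have D_int: "integrable M (D n)" for n
    using D_bounded[of n] D_adapted[of n] measurable_M integrable_bdd by metis
  have D_0: "expectation (D n) = 0" for n using D_orthogonal[of "\<lambda>_. 1" n 1] by simp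
  have V0: "0 \<le> expectation (V n)" for n
    by (rule Bochner_Integration.integral_nonneg) (use V_nonneg in auto)
  have b0: "0 \<le> b n" for n
    using order_trans[OF Bochner_Integration.integral_nonneg R_le[of n]] R_nonneg by blast
  \<comment> \<open>Discrete Gronwall argument: because \<open>1 + expectation (V n)\<close> is at
    least 1, the additive error \<open>b n\<close> can be absorbed into the factor. The factors
    multiply up to the constant \<open>C\<close> below.\<close>
  have step: "1 + expectation (V (Suc n)) \<le> (1 + expectation (V n)) * exp (a n + b n)" for n
  proof -
    have "expectation (V (Suc n)) \<le> expectation (\<lambda>\<omega>. V n \<omega> + D n \<omega> + R n \<omega> + a n * (1 + V n \<omega>))"
    proof (rule integral_mono)
      show "integrable M (\<lambda>\<omega>. V n \<omega> + D n \<omega> + R n \<omega> + a n * (1 + V n \<omega>))"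
        using V_int D_int R_int by (intro Bochner_Integration.integrable_add integrable_mult_right) auto
      show "V (Suc n) \<omega> \<le> V n \<omega> + D n \<omega> + R n \<omega> + a n * (1 + V n \<omega>)" if "\<omega> \<in> space M" for \<omega>
        using rec[OF that, of n] e_le[OF that, of n] g_nonneg[OF that, of n] by linarith
    qed (rule V_int)
    also have "\<dots> = expectation (V n) + expectation (R n) + a n * (1 + expectation (V n))"
      using V_int D_int R_int D_0[of n] by (simp add: prob_space)
    also have "\<dots> \<le> expectation (V n) + b n + a n * (1 + expectation (V n))" using R_le by simp
    finally have "1 + expectation (V (Suc n)) \<le> 1 + expectation (V n) + b n * 1 + a n * (1 + expectation (V n))" by simp
    also have "\<dots> \<le> 1 + expectation (V n) + b n * (1 + expectation (V n)) + a n * (1 + expectation (V n))"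
      using mult_left_mono[OF _ b0[of n], of 1 "1 + expectation (V n)"] V0[of n] by simp
    also have "\<dots> = (1 + expectation (V n)) * (1 + (a n + b n))" by (simp add: algebra_simps)
    also have "\<dots> \<le> (1 + expectation (V n)) * exp (a n + b n)"
      using V0[of n] by (intro mult_left_mono exp_ge_add_one_self) auto
    finally show ?thesis .
  qed
  define C where "C = (1 + expectation (V 0)) * exp (\<Sum>k. a k + b k)"
  have EV: "1 + expectation (V n) \<le> C" for n
  proof -
    have "1 + expectation (V n) \<le> (1 + expectation (V 0)) * exp (\<Sum>k<n. a k + b k)"
    proof (induction n)
      case (Suc n)
      show ?case using order_trans[OF step[of n] mult_right_mono[OF Suc, of "exp (a n + b n)"]]
        by (simp add: exp_add mult_ac)
    qed simp
    also have "\<dots> \<le> C" unfolding C_def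
      using V0[of 0] a_nonneg b0 sa sb by (intro mult_left_mono) (auto intro!: sum_le_suminf summable_add)
    finally show ?thesis .
  qed
  have "AE \<omega> in M. summable (\<lambda>n. D n \<omega>)"
  proof (rule AE_summable, rule summable_comparison_test')
    show "summable (\<lambda>n. c n * C)" using sc by (rule summable_mult2)
    show "norm (expectation (\<lambda>\<omega>. (D n \<omega>)\<^sup>2)) \<le> c n * C" if "n \<ge> 0" for n
      using order_trans[OF D_le[of n] mult_left_mono[OF EV[of n] c_nonneg[of n]]] by simp
  qed
  moreover have "AE \<omega> in M. summable (\<lambda>n. R n \<omega>)"
    by (rule AE_summable_nonneg[OF R_int R_nonneg R_le sb])
  moreover have "AE \<omega> in M. summable (\<lambda>n. a n * (1 + V n \<omega>))"
  proof (rule AE_summable_nonneg)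
    show "expectation (\<lambda>\<omega>. a n * (1 + V n \<omega>)) \<le> a n * C" for n
      using V_int mult_left_mono[OF EV[of n] a_nonneg[of n]] by (simp add: prob_space)
    show "summable (\<lambda>n. a n * C)" using sa by (rule summable_mult2)
  qed (use V_int V_nonneg a_nonneg in \<open>auto intro!: integrable_mult_right Bochner_Integration.integrable_add\<close>)
  ultimately show ?thesis using AE_space
  proof eventually_elim
    fix \<omega> assume sD: "summable (\<lambda>n. D n \<omega>)" and sR: "summable (\<lambda>n. R n \<omega>)"
      and sV: "summable (\<lambda>n. a n * (1 + V n \<omega>))" and w: "\<omega> \<in> space M"
    define T where "T n = D n \<omega> + R n \<omega> + a n * (1 + V n \<omega>)" for n
    \<comment> \<open>The slack in the upper bound of the drift, which dominates \<open>g\<close>.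
      Since \<open>V n\<close> is \<open>V 0\<close> plus convergent partial sums minus the sum of
      this nonnegative slack, and \<open>V n\<close> cannot become negative, the slack is summable.
      This gives both claims at once.\<close>
    define s where "s n = a n * (1 + V n \<omega>) - e n \<omega>" for n
    have sT: "summable T" unfolding T_def[abs_def] by (intro summable_add sD sR sV)
    have sg: "g n \<omega> \<le> s n" for n using e_le[OF w, of n] by (simp add: s_def)
    have s0: "0 \<le> s n" for n using sg[of n] g_nonneg[OF w, of n] by linarith
    have VT: "V n \<omega> = V 0 \<omega> + (\<Sum>k<n. T k) - (\<Sum>k<n. s k)" for n
      by (induction n) (simp_all add: rec[OF w] T_def s_def)
    obtain B where B: "\<And>n. \<bar>\<Sum>k<n. T k\<bar> \<le> B"
      using convergent_imp_Bseq[OF sT[unfolded summable_iff_convergent]] by (auto simp: Bseq_def)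
    have "summable s"
    proof (rule summableI_nonneg_bounded[OF s0])
      show "(\<Sum>k<n. s k) \<le> V 0 \<omega> + B" for n using VT[of n] V_nonneg[OF w, of n] B[of n] by linarith
    qed
    moreover have "convergent (\<lambda>n. V n \<omega>)"
      by (subst VT, intro convergent_diff convergent_add convergent_const)
        (use sT \<open>summable s\<close> in \<open>simp_all add: summable_iff_convergent\<close>)
    moreover have "summable (\<lambda>n. g n \<omega>)"
      by (rule summable_comparison_test'[OF \<open>summable s\<close>, of 0]) (use sg g_nonneg[OF w] in auto)
    ultimately show "convergent (\<lambda>n. V n \<omega>) \<and> summable (\<lambda>n. g n \<omega>)" by simp
  qed
qed

end

section \<open>Separation of the geometric median\<close>

text \<open>The Gram determinant factors as a difference of squares, and the factor
  \<open>norm a * norm b - inner a b\<close> is half of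
  \<open>(norm a + norm b)\<^sup>2 - (norm (a + b))\<^sup>2\<close>. Near equality in the triangle
  inequality thus forces near parallelism.\<close>

lemma norm_add_defect:
  fixes a b :: "'h::real_inner"
  shows "(norm a)\<^sup>2 * (norm b)\<^sup>2 - (inner a b)\<^sup>2
    \<le> 2 * norm a * norm b * (norm a + norm b) * (norm a + norm b - norm (a + b))"
proof -
  have e: "(norm (a + b))\<^sup>2 = (norm a)\<^sup>2 + 2 * inner a b + (norm b)\<^sup>2"
    by (simp add: power2_norm_eq_inner inner_add inner_commute algebra_simps)
  have c: "\<bar>inner a b\<bar> \<le> norm a * norm b" by (rule Cauchy_Schwarz_ineq2)
  have t: "norm (a + b) \<le> norm a + norm b" by (rule norm_triangle_ineq)
  have "(norm a)\<^sup>2 * (norm b)\<^sup>2 - (inner a b)\<^sup>2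
    = (norm a * norm b + inner a b) * (norm a * norm b - inner a b)"
    by (simp add: power2_eq_square algebra_simps)
  also have "\<dots> \<le> (2 * norm a * norm b) * (norm a * norm b - inner a b)"
    using c by (intro mult_right_mono) auto
  also have "norm a * norm b - inner a b = (norm a + norm b + norm (a + b)) * (norm a + norm b - norm (a + b)) / 2"
    using e by (simp add: power2_eq_square algebra_simps)
  also have "(2 * norm a * norm b) * ((norm a + norm b + norm (a + b)) * (norm a + norm b - norm (a + b)) / 2)
    \<le> (2 * norm a * norm b) * ((2 * (norm a + norm b)) * (norm a + norm b - norm (a + b)) / 2)"
    using t by (intro mult_left_mono divide_right_mono mult_right_mono) auto
  finally show ?thesis by (simp add: algebra_simps)
qed

text \<open>A Gram determinant is invariant under shears. With \<open>a = y - a k\<close> and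
  \<open>b = y - m\<close> the difference \<open>b - a\<close> is \<open>a k - m\<close>, which no
  longer depends on \<open>y\<close>.\<close>

lemma Gram_diff:
  fixes a b :: "'h::real_inner"
  shows "(norm (b - a))\<^sup>2 * (norm b)\<^sup>2 - (inner (b - a) b)\<^sup>2 = (norm a)\<^sup>2 * (norm b)\<^sup>2 - (inner a b)\<^sup>2"
  unfolding power2_norm_eq_inner
  by (simp add: inner_diff_left inner_diff_right inner_commute power2_eq_square algebra_simps)

text \<open>If the same directions \<open>d k\<close> become parallel to both \<open>b\<close> and
  \<open>b0\<close>, then \<open>b\<close> lies on the line of \<open>b0\<close>, so everything
  orthogonal to \<open>b0\<close> is orthogonal to \<open>b\<close>. The \<open>d k\<close> need not
  converge, not even along a subsequence; the lower bound \<open>e\<close> on their norms takes the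
  place of compactness.\<close>

lemma inner_zero_if_asymptotically_parallel:
  fixes d :: "nat \<Rightarrow> 'h::real_inner"
  assumes e: "e > 0" and d1: "\<And>k. norm (d k) \<ge> e" and d2: "\<And>k. norm (d k) \<le> R"
    and b: "(\<lambda>k. (norm (d k))\<^sup>2 * (norm b)\<^sup>2 - (inner (d k) b)\<^sup>2) \<longlonglongrightarrow> 0"
    and b0: "(\<lambda>k. (norm (d k))\<^sup>2 * (norm b0)\<^sup>2 - (inner (d k) b0)\<^sup>2) \<longlonglongrightarrow> 0"
    and nz: "b0 \<noteq> 0" and w: "inner b0 w = 0"
  shows "inner w b = 0"
proof -
  have R: "R > 0" using e d1[of 0] d2[of 0] by linarith
  define A where "A c k = (norm (d k))\<^sup>2 * (norm c)\<^sup>2 - (inner (d k) c)\<^sup>2" for c k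
  \<comment> \<open>This is \<open>(norm (d k))\<^sup>2\<close> times the inner product of
    \<open>w\<close> with the component of \<open>c\<close> orthogonal to \<open>d k\<close>; the
    scaling avoids a division. It is small when \<open>c\<close> is nearly parallel to
    \<open>d k\<close>.\<close>
  define P where "P c k = (norm (d k))\<^sup>2 * inner w c - inner (d k) c * inner (d k) w" for c k
  have PA: "(P c k)\<^sup>2 \<le> (norm w)\<^sup>2 * R\<^sup>2 * A c k" for c k
  proof -
    define v where "v = (norm (d k))\<^sup>2 *\<^sub>R c - inner (d k) c *\<^sub>R d k"
    have v: "(norm v)\<^sup>2 = (norm (d k))\<^sup>2 * A c k"
      unfolding v_def A_def power2_norm_eq_inner
      by (simp add: inner_diff_left inner_diff_right inner_commute power2_eq_square algebra_simps)
    have A0: "A c k \<ge> 0"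
      using Cauchy_Schwarz_ineq[of "d k" c] by (simp add: A_def power2_norm_eq_inner)
    have "P c k = inner w v" by (simp add: P_def v_def inner_diff_right inner_commute)
    then have "(P c k)\<^sup>2 \<le> (norm w)\<^sup>2 * (norm v)\<^sup>2"
      using Cauchy_Schwarz_ineq[of w v] by (simp add: power2_norm_eq_inner)
    also have "\<dots> \<le> (norm w)\<^sup>2 * (R\<^sup>2 * A c k)"
      unfolding v using A0 d2[of k] by (intro mult_left_mono mult_right_mono power_mono) auto
    finally show ?thesis by simp
  qed
  have Plim: "P c \<longlonglongrightarrow> 0" if "A c \<longlonglongrightarrow> 0" for c
  proof -
    have "(\<lambda>k. (norm w)\<^sup>2 * R\<^sup>2 * A c k) \<longlonglongrightarrow> 0" using tendsto_mult_right_zero[OF that] by simp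
    then have "(\<lambda>k. (P c k)\<^sup>2) \<longlonglongrightarrow> 0"
      by (rule tendsto_sandwich[OF _ _ tendsto_const, rotated 2]) (use PA in auto)
    then have "(\<lambda>k. sqrt ((P c k)\<^sup>2)) \<longlonglongrightarrow> sqrt 0" by (rule tendsto_real_sqrt)
    then show ?thesis by (simp add: tendsto_rabs_zero_iff)
  qed
  have Ab: "A b \<longlonglongrightarrow> 0" and Ab0: "A b0 \<longlonglongrightarrow> 0" using b b0 unfolding A_def[abs_def] by simp_all
  have "(\<lambda>k. (inner (d k) w)\<^sup>2) \<longlonglongrightarrow> 0"
  proof (rule tendsto_sandwich[OF _ _ tendsto_const])
    \<comment> \<open>As \<open>w\<close> is orthogonal to \<open>b0\<close>, \<open>P b0 k\<close>
      reduces to \<open>- inner (d k) b0 * inner (d k) w\<close>. Multiplying the definition of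
      \<open>A b0 k\<close> by \<open>(inner (d k) w)\<^sup>2\<close> then isolates that square, and
      the lower bound on \<open>norm (d k)\<close> allows the division.\<close>
    let ?u = "\<lambda>k. ((P b0 k)\<^sup>2 + (norm w)\<^sup>2 * R\<^sup>2 * A b0 k) / (e\<^sup>2 * (norm b0)\<^sup>2)"
    have "?u \<longlonglongrightarrow> (0\<^sup>2 + (norm w)\<^sup>2 * R\<^sup>2 * 0) / (e\<^sup>2 * (norm b0)\<^sup>2)"
      using nz e by (intro tendsto_intros Plim Ab0) auto
    then show "?u \<longlonglongrightarrow> 0" by simp
    have "(inner (d k) w)\<^sup>2 \<le> ?u k" for k
    proof -
      have A0: "A b0 k \<ge> 0"
        using Cauchy_Schwarz_ineq[of "d k" b0] by (simp add: A_def power2_norm_eq_inner)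
      have "(e\<^sup>2 * (norm b0)\<^sup>2) * (inner (d k) w)\<^sup>2 \<le> ((norm (d k))\<^sup>2 * (norm b0)\<^sup>2) * (inner (d k) w)\<^sup>2"
        using d1[of k] e by (intro mult_right_mono power_mono) auto
      also have "\<dots> = (P b0 k)\<^sup>2 + (inner (d k) w)\<^sup>2 * A b0 k"
        using w by (simp add: P_def A_def inner_commute power2_eq_square algebra_simps)
      also have "(inner (d k) w)\<^sup>2 \<le> (norm w)\<^sup>2 * R\<^sup>2"
      proof -
        have "(inner (d k) w)\<^sup>2 \<le> (norm (d k))\<^sup>2 * (norm w)\<^sup>2"
          using Cauchy_Schwarz_ineq[of "d k" w] by (simp add: power2_norm_eq_inner)
        also have "\<dots> \<le> R\<^sup>2 * (norm w)\<^sup>2" using d2[of k] by (intro mult_right_mono power_mono) auto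
        finally show ?thesis by (simp add: mult.commute)
      qed
      finally show ?thesis using A0 nz e by (simp add: field_simps mult_right_mono)
    qed
    then show "eventually (\<lambda>k. (inner (d k) w)\<^sup>2 \<le> ?u k) sequentially" by simp
  qed simp
  then have "(\<lambda>k. sqrt ((inner (d k) w)\<^sup>2)) \<longlonglongrightarrow> sqrt 0" by (rule tendsto_real_sqrt)
  then have dw: "(\<lambda>k. inner (d k) w) \<longlonglongrightarrow> 0" by (simp add: tendsto_rabs_zero_iff)
  have "(\<lambda>k. inner (d k) b * inner (d k) w) \<longlonglongrightarrow> 0"
  proof (rule Lim_null_comparison)
    have "\<bar>inner (d k) b\<bar> \<le> R * norm b" for k
      using Cauchy_Schwarz_ineq2[of "d k" b] mult_right_mono[OF d2[of k], of "norm b"] by simp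
    then show "eventually (\<lambda>k. norm (inner (d k) b * inner (d k) w) \<le> R * norm b * \<bar>inner (d k) w\<bar>) sequentially"
      by (intro always_eventually allI) (simp add: abs_mult mult_right_mono)
    show "(\<lambda>k. R * norm b * \<bar>inner (d k) w\<bar>) \<longlonglongrightarrow> 0"
      using tendsto_mult_right_zero[OF tendsto_rabs_zero[OF dw]] by simp
  qed
  from tendsto_add[OF Plim[OF Ab] this] have l: "(\<lambda>k. (norm (d k))\<^sup>2 * inner w b) \<longlonglongrightarrow> 0"
    by (simp add: P_def)
  have "e\<^sup>2 * \<bar>inner w b\<bar> \<le> \<bar>(norm (d k))\<^sup>2 * inner w b\<bar>" for k
    using d1[of k] e by (auto simp: abs_mult intro!: mult_right_mono power_mono)
  then have "e\<^sup>2 * \<bar>inner w b\<bar> \<le> 0"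
    by (intro LIMSEQ_le_const[OF tendsto_rabs_zero[OF l]]) auto
  then show ?thesis using e by (simp add: mult_le_0_iff)
qed

text \<open>Subtracting \<open>norm y\<close> leaves a function bounded by
  \<open>norm \<alpha>\<close>, so no moment of the law is required.\<close>

lemma integrable_norm_diff:
  fixes Q :: "'h::{real_inner,banach,second_countable_topology} measure"
  assumes "prob_space Q" and [measurable_cong]: "sets Q = sets borel"
  shows "integrable Q (\<lambda>y. norm (y - \<alpha>) - norm y)"
proof -
  interpret prob_space Q by fact
  show ?thesis
    by (rule integrable_const_bound[of _ "norm \<alpha>"])
      (auto simp: norm_triangle_ineq3 intro!: AE_I2 order_trans[OF norm_triangle_ineq3])
qed

text \<open>Along a minimising sequence \<open>a k\<close> the midpoint convexity defect tends to zero almost everywhere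
  (the gaps are summable), so almost every \<open>y - m\<close> is asymptotically parallel to \<open>a k - m\<close>, and the law
  would live on a line. This replaces the weak compactness argument one
  might expect in infinite dimension.\<close>

lemma median_well_separated:
  fixes Q :: "'h::{real_inner,banach,second_countable_topology} measure"
  assumes Q: "prob_space Q" and sQ[measurable_cong]: "sets Q = sets borel"
    and nondeg: "\<And>v. \<exists>w. inner v w = 0 \<and> ext_variance Q (\<lambda>y. inner w y) > 0"
    and min: "\<And>\<alpha>. (\<integral>y. norm (y - m) - norm y \<partial>Q) \<le> (\<integral>y. norm (y - \<alpha>) - norm y \<partial>Q)"
    and e: "e > 0"
  shows "\<exists>c>0. \<forall>\<alpha>. e \<le> norm (\<alpha> - m) \<longrightarrow> norm (\<alpha> - m) \<le> R \<longrightarrow>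
    c \<le> (\<integral>y. norm (y - \<alpha>) - norm y \<partial>Q) - (\<integral>y. norm (y - m) - norm y \<partial>Q)"
proof (rule ccontr)
  interpret prob_space Q by fact
  define g where "g \<alpha> = (\<integral>y. norm (y - \<alpha>) - norm y \<partial>Q)" for \<alpha>
  have gi: "integrable Q (\<lambda>y. norm (y - \<alpha>) - norm y)" for \<alpha>
    by (rule integrable_norm_diff[OF Q sQ])
  assume "\<not> ?thesis"
  then have "\<forall>k. \<exists>\<alpha>. e \<le> norm (\<alpha> - m) \<and> norm (\<alpha> - m) \<le> R \<and> g \<alpha> - g m < (1/2) ^ k"
    by (auto simp: g_def not_le dest!: spec[of _ "(1/2) ^ _"])
  then obtain a where a1: "\<And>k. e \<le> norm (a k - m)" and a2: "\<And>k. norm (a k - m) \<le> R"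
    and a3: "\<And>k. g (a k) - g m < (1/2) ^ k" by metis
  \<comment> \<open>Twice the convexity defect of the norm at the midpoint of \<open>a k\<close> and
    \<open>m\<close>. Its mean is at most \<open>g (a k) - g m\<close>, because the midpoint cannot
    have a value below the minimum.\<close>
  define \<delta> where "\<delta> k y = norm (y - a k) + norm (y - m) - norm ((y - a k) + (y - m))" for k y
  have \<delta>0: "\<delta> k y \<ge> 0" for k y unfolding \<delta>_def using norm_triangle_ineq[of "y - a k" "y - m"] by simp
  define mid where "mid k = (1/2) *\<^sub>R (a k + m)" for k
  have \<delta>eq: "\<delta> k = (\<lambda>y. (norm (y - a k) - norm y) + (norm (y - m) - norm y) - 2 * (norm (y - mid k) - norm y))" for k
  proof
    fix y
    have "(y - a k) + (y - m) = 2 *\<^sub>R (y - mid k)" by (simp add: mid_def algebra_simps scaleR_2)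
    then have "norm ((y - a k) + (y - m)) = 2 * norm (y - mid k)" by simp
    then show "\<delta> k y = (norm (y - a k) - norm y) + (norm (y - m) - norm y) - 2 * (norm (y - mid k) - norm y)"
      by (simp add: \<delta>_def)
  qed
  have \<delta>i: "integrable Q (\<delta> k)" for k unfolding \<delta>eq
    by (intro Bochner_Integration.integrable_diff Bochner_Integration.integrable_add integrable_mult_right gi)
  have \<delta>E: "expectation (\<delta> k) \<le> (1/2) ^ k" for k
  proof -
    have "expectation (\<delta> k) = g (a k) + g m - 2 * g (mid k)" unfolding \<delta>eq g_def
      by (simp only: Bochner_Integration.integral_diff Bochner_Integration.integral_add integral_mult_right_zero
        gi Bochner_Integration.integrable_add integrable_mult_right)
    also have "\<dots> \<le> g (a k) - g m" using min[of "mid k"] by (simp add: g_def)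
    finally show ?thesis using a3[of k] by simp
  qed
  have [measurable]: "\<delta> k \<in> borel_measurable Q" for k using \<delta>i by blast
  have "AE y in Q. summable (\<lambda>k. \<delta> k y)"
    by (rule AE_summable_nonneg[OF \<delta>i _ \<delta>E]) (auto intro: \<delta>0 summable_geometric)
  then have AE0: "AE y in Q. (\<lambda>k. \<delta> k y) \<longlonglongrightarrow> 0"
    by eventually_elim (rule summable_LIMSEQ_zero)
  define A where "A y k = (norm (a k - m))\<^sup>2 * (norm (y - m))\<^sup>2 - (inner (a k - m) (y - m))\<^sup>2" for y k
  have Alim: "A y \<longlonglongrightarrow> 0" if y: "(\<lambda>k. \<delta> k y) \<longlonglongrightarrow> 0" for y
  proof (rule tendsto_sandwich[OF _ _ tendsto_const])
    let ?r = "norm (y - m)"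
    \<comment> \<open>The coefficient of \<open>norm_add_defect\<close> with
      \<open>norm (y - a k)\<close> replaced by its bound \<open>?r + R\<close>: it depends on
      \<open>y\<close> but not on \<open>k\<close>.\<close>
    let ?C = "2 * (?r + R) * ?r * ((?r + R) + ?r)"
    show "(\<lambda>k. ?C * \<delta> k y) \<longlonglongrightarrow> 0" using tendsto_mult_right_zero[OF y] by simp
    have "0 \<le> A y k" for k
      using Cauchy_Schwarz_ineq[of "a k - m" "y - m"] by (simp add: A_def power2_norm_eq_inner)
    then show "eventually (\<lambda>k. 0 \<le> A y k) sequentially" by simp
    have R0: "R \<ge> 0" using a2[of 0] norm_ge_zero order_trans by blast
    have "A y k \<le> ?C * \<delta> k y" for k
    proof -
      have "norm (y - a k) \<le> norm (y - m) + norm (m - a k)"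
        using norm_triangle_ineq[of "y - m" "m - a k"] by simp
      then have r: "norm (y - a k) \<le> ?r + R" using a2[of k] by (simp add: norm_minus_commute)
      have "A y k = (norm (y - a k))\<^sup>2 * ?r\<^sup>2 - (inner (y - a k) (y - m))\<^sup>2"
        using Gram_diff[where a = "y - a k" and b = "y - m"] by (simp add: A_def norm_minus_commute)
      also have "\<dots> \<le> 2 * norm (y - a k) * ?r * (norm (y - a k) + ?r) * \<delta> k y"
        unfolding \<delta>_def by (rule norm_add_defect)
      also have "\<dots> \<le> ?C * \<delta> k y"
        using r \<delta>0 norm_ge_zero[of "y - a k"] R0 by (intro mult_mono mult_nonneg_nonneg) auto
      finally show ?thesis .
    qed
    then show "eventually (\<lambda>k. A y k \<le> ?C * \<delta> k y) sequentially" by simp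
  qed
  have var0: "ext_variance Q (\<lambda>y. inner w y) = 0" if ae: "AE y in Q. inner w (y - m) = 0" for w
  proof -
    have ae': "AE y in Q. inner w y = inner w m"
      using ae by eventually_elim (simp add: inner_diff_right)
    have "(\<integral>y. inner w y \<partial>Q) = (\<integral>y. inner w m \<partial>Q)"
      by (rule integral_cong_AE) (use ae' in auto)
    then have i: "(\<integral>y. inner w y \<partial>Q) = inner w m" by (simp add: prob_space)
    have "ext_variance Q (\<lambda>y. inner w y) = (\<integral>\<^sup>+y. 0 \<partial>Q)"
      unfolding ext_variance_def i by (rule nn_integral_cong_AE) (use ae' in eventually_elim, simp)
    then show ?thesis by simp
  qed
  show False
  \<comment> \<open>A law concentrated at \<open>m\<close> has no variance in any direction.
    Otherwise some typical \<open>y0\<close> differs from \<open>m\<close>, and it fixes the line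
    that carries the law; nondegeneracy is applied to \<open>y0 - m\<close>.\<close>
  proof (cases "AE y in Q. y = m")
    case True
    obtain w where "ext_variance Q (\<lambda>y. inner w y) > 0" using nondeg[of 0] by blast
    moreover have "ext_variance Q (\<lambda>y. inner w y) = 0"
      by (rule var0) (use True in eventually_elim, simp)
    ultimately show False by simp
  next
    case False
    then have "\<exists>y0. y0 \<noteq> m \<and> (\<lambda>k. \<delta> k y0) \<longlonglongrightarrow> 0"
      using AE0 by (metis (mono_tags, lifting) eventually_mono)
    then obtain y0 where y0: "y0 \<noteq> m" "A y0 \<longlonglongrightarrow> 0" using Alim by blast
    obtain w where w: "inner (y0 - m) w = 0" "ext_variance Q (\<lambda>y. inner w y) > 0"
      using nondeg[of "y0 - m"] by blast
    have "ext_variance Q (\<lambda>y. inner w y) = 0"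
    proof (rule var0, use AE0 in eventually_elim)
      fix y assume "(\<lambda>k. \<delta> k y) \<longlonglongrightarrow> 0"
      from Alim[OF this] show "inner w (y - m) = 0"
        using y0 w unfolding A_def
        by (intro inner_zero_if_asymptotically_parallel[OF e a1 a2, where b = "y - m" and ?b0.0 = "y0 - m"]) auto
    qed
    with w show False by simp
  qed
qed

section \<open>Joint law and independence of the past\<close>

text \<open>The hypothesis \<open>law\<close> speaks of rectangles only. They form a generator
  stable under intersection, which identifies the law of the pair with the mixture of the
  conditional laws over the density \<open>p\<close>.\<close>

lemma expectation_joint_law:
  fixes M :: "'a measure" and X :: "'a \<Rightarrow> real"
    and Y :: "'a \<Rightarrow> 'h::{real_inner,banach,second_countable_topology}"
    and f :: "real \<times> 'h \<Rightarrow> real"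
  assumes M: "prob_space M"
    and [measurable]: "X \<in> borel_measurable M" "Y \<in> borel_measurable M"
    and p [measurable]: "p \<in> borel_measurable borel" and p0: "\<And>u. p u \<ge> 0"
    and mu_prob: "\<And>u. prob_space (mu u)" and mu_sets [measurable_cong]: "\<And>u. sets (mu u) = sets borel"
    and mu [measurable]: "mu \<in> borel \<rightarrow>\<^sub>M subprob_algebra borel"
    and law: "\<And>A B. A \<in> sets borel \<Longrightarrow> B \<in> sets borel \<Longrightarrow>
        measure M {\<omega> \<in> space M. X \<omega> \<in> A \<and> Y \<omega> \<in> B} = (LINT u:A|lborel. p u * measure (mu u) B)"
    and f [measurable]: "f \<in> borel_measurable (borel \<Otimes>\<^sub>M borel)" and f_bdd: "\<And>z. \<bar>f z\<bar> \<le> B"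
  shows "(\<integral>\<omega>. f (X \<omega>, Y \<omega>) \<partial>M) = (\<integral>u. p u * (\<integral>y. f (u, y) \<partial>mu u) \<partial>lborel)"
proof -
  interpret prob_space M by fact
  have mu1: "measure (mu u) UNIV = 1" for u
    using prob_space.prob_space[OF mu_prob, of u] sets_eq_imp_space_eq[OF mu_sets, of u] by simp
  \<comment> \<open>The total mass of \<open>p\<close> is read off from \<open>law\<close> on the
    full product. As the Bochner integral of a nonintegrable function is 0, the value 1 also yields
    integrability.\<close>
  have "(\<integral>u. p u \<partial>lborel) = 1"
    using law[of UNIV UNIV] by (simp add: mu1 prob_space set_lebesgue_integral_def)
  then have pi: "integrable lborel p" and p1: "(\<integral>\<^sup>+u. ennreal (p u) \<partial>lborel) = 1"
    using not_integrable_integral_eq[of lborel p] nn_integral_eq_integral[of lborel p] p0 by force+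
  define P where "P = density lborel p"
  have P: "prob_space P" unfolding P_def using p1 by (intro prob_spaceI) (simp add: emeasure_density)
  have [measurable_cong, simp]: "sets P = sets borel" by (simp add: P_def)
  have [simp]: "space P = UNIV" by (simp add: P_def)
  let ?S = "borel \<Otimes>\<^sub>M borel :: (real \<times> 'h) measure"
  \<comment> \<open>The conditional law of the whole pair given the first coordinate
    \<open>u\<close>; carrying \<open>u\<close> along lets \<open>f\<close> depend on both
    coordinates.\<close>
  define N where "N u = distr (mu u) ?S (Pair u)" for u
  have N [measurable]: "N \<in> borel \<rightarrow>\<^sub>M subprob_algebra ?S"
    unfolding N_def by (rule measurable_distr2[where M=borel]) measurable
  then have NP [measurable]: "N \<in> P \<rightarrow>\<^sub>M subprob_algebra ?S" by measurable
  have "distr M ?S (\<lambda>\<omega>. (X \<omega>, Y \<omega>)) = P \<bind> N"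
  proof (rule measure_eqI_generator_eq[OF Int_stable_pair_measure_generator[of borel borel],
        where \<Omega> = UNIV and A = "\<lambda>_. UNIV"])
    show "sets (distr M ?S (\<lambda>\<omega>. (X \<omega>, Y \<omega>))) = sigma_sets UNIV {a \<times> b |a b. a \<in> sets borel \<and> b \<in> sets borel}"
      by (simp add: sets_pair_measure)
    have "sets (P \<bind> N) = sets ?S" by (rule sets_bind) (auto simp: N_def)
    then show "sets (P \<bind> N) = sigma_sets UNIV {a \<times> b |a b. a \<in> sets borel \<and> b \<in> sets borel}"
      by (simp add: sets_pair_measure)
    have "finite_measure (distr M ?S (\<lambda>\<omega>. (X \<omega>, Y \<omega>)))" by (rule finite_measure_distr) measurable
    then show "emeasure (distr M ?S (\<lambda>\<omega>. (X \<omega>, Y \<omega>))) UNIV \<noteq> \<infinity>"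
      using finite_measure.emeasure_finite by auto
    show "range (\<lambda>_::nat. UNIV :: (real \<times> 'h) set) \<subseteq> {a \<times> b |a b. a \<in> sets borel \<and> b \<in> sets borel}"
      by (intro image_subsetI CollectI exI[of _ UNIV]) simp
  next
    fix E :: "(real \<times> 'h) set" assume "E \<in> {a \<times> b |a b. a \<in> sets borel \<and> b \<in> sets borel}"
    then obtain a b where E: "E = a \<times> b" and [measurable]: "a \<in> sets borel" "b \<in> sets borel" by auto
    have mub: "emeasure (mu u) b = ennreal (measure (mu u) b)" for u
      using finite_measure.emeasure_eq_measure[OF prob_space.finite_measure[OF mu_prob]] by blast
    have mub1: "measure (mu u) b \<le> 1" for u by (rule prob_space.prob_le_1[OF mu_prob])
    have mm [measurable]: "(\<lambda>u. measure (mu u) b) \<in> borel_measurable borel"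
      by (rule measurable_compose[OF mu measurable_measure_subprob_algebra]) auto
    have "emeasure (distr M ?S (\<lambda>\<omega>. (X \<omega>, Y \<omega>))) E = emeasure M {\<omega> \<in> space M. X \<omega> \<in> a \<and> Y \<omega> \<in> b}"
      unfolding E by (subst emeasure_distr) (auto intro!: arg_cong[where f="emeasure M"])
    also have "\<dots> = ennreal (LINT u:a|lborel. p u * measure (mu u) b)"
      by (simp add: emeasure_eq_measure law)
    also have "\<dots> = (\<integral>\<^sup>+u. ennreal (indicator a u * (p u * measure (mu u) b)) \<partial>lborel)"
      unfolding set_lebesgue_integral_def real_scaleR_def
    proof (rule nn_integral_eq_integral[symmetric])
      show "integrable lborel (\<lambda>u. indicator a u * (p u * measure (mu u) b))"
        by (rule Bochner_Integration.integrable_bound[OF pi])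
          (use p0 mub1 in \<open>auto simp: indicator_def abs_mult mult_left_le\<close>)
    qed (use p0 in auto)
    also have "\<dots> = (\<integral>\<^sup>+u. ennreal (p u) * (indicator a u * emeasure (mu u) b) \<partial>lborel)"
      using p0 by (intro nn_integral_cong) (auto simp: mub indicator_def ennreal_mult)
    also have "\<dots> = (\<integral>\<^sup>+u. indicator a u * emeasure (mu u) b \<partial>P)"
      unfolding P_def mub by (subst nn_integral_density) auto
    also have "\<dots> = (\<integral>\<^sup>+u. emeasure (N u) E \<partial>P)"
    proof (rule nn_integral_cong)
      fix u
      have "Pair u -` (a \<times> b) \<inter> space (mu u) = (if u \<in> a then b else {})"
        using sets_eq_imp_space_eq[OF mu_sets, of u] by auto
      then show "indicator a u * emeasure (mu u) b = emeasure (N u) E"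
        unfolding N_def E by (subst emeasure_distr) (auto simp: indicator_def)
    qed
    also have "\<dots> = emeasure (P \<bind> N) E"
      by (rule emeasure_bind[OF _ NP, symmetric]) (auto simp: E)
    finally show "emeasure (distr M ?S (\<lambda>\<omega>. (X \<omega>, Y \<omega>))) E = emeasure (P \<bind> N) E" .
  qed auto
  then have "(\<integral>\<omega>. f (X \<omega>, Y \<omega>) \<partial>M) = integral\<^sup>L (P \<bind> N) f"
    using integral_distr[of "\<lambda>\<omega>. (X \<omega>, Y \<omega>)" M ?S f] by simp
  also have "\<dots> = (\<integral>u. integral\<^sup>L (N u) f \<partial>P)"
  proof (rule integral_bind[where B'=1, OF f _ NP])
    show "AE u in P. emeasure (N u) (space (N u)) \<le> ennreal 1"
    proof (rule AE_I2)
      fix u assume "u \<in> space P"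
      then have "subprob_space (N u)" by (rule subprob_space_kernel[OF NP])
      then show "emeasure (N u) (space (N u)) \<le> ennreal 1"
        using subprob_space.emeasure_space_le_1 by fastforce
    qed
  qed (use f_bdd P prob_space.finite_measure in blast)+
  also have "\<dots> = (\<integral>u. (\<integral>y. f (u, y) \<partial>mu u) \<partial>P)"
    unfolding N_def by (subst integral_distr) auto
  also have "\<dots> = (\<integral>u. p u * (\<integral>y. f (u, y) \<partial>mu u) \<partial>lborel)"
  proof -
    have "(\<lambda>u. integral\<^sup>L (N u) f) \<in> borel_measurable borel"
      by (rule measurable_compose[OF N integral_measurable_subprob_algebra[OF f]])
    moreover have "integral\<^sup>L (N u) f = (\<integral>y. f (u, y) \<partial>mu u)" for u
      unfolding N_def by (subst integral_distr) auto
    ultimately have [measurable]: "(\<lambda>u. \<integral>y. f (u, y) \<partial>mu u) \<in> borel_measurable borel" by simp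
    show ?thesis unfolding P_def by (subst integral_density) (auto intro: p0)
  qed
  finally show ?thesis .
qed

text \<open>The vector of the first \<open>n\<close> variables generates the past, in the form in
  which \<open>indep_var_restrict\<close> separates blocks of coordinates. Indices start at 1, so
  \<open>n = 0\<close> gives the trivial sigma-algebra.\<close>

definition history :: "'a measure \<Rightarrow> 'b measure \<Rightarrow> (nat \<Rightarrow> 'a \<Rightarrow> 'b) \<Rightarrow> nat \<Rightarrow> 'a measure" where
  "history M S W n = vimage_algebra (space M) (\<lambda>\<omega>. \<lambda>i\<in>{1..n}. W i \<omega>) (PiM {1..n} (\<lambda>_. S))"

lemma space_history [simp]: "space (history M S W n) = space M"
  by (simp add: history_def)

lemma measurable_history:
  assumes "\<And>i. i \<in> {1..n} \<Longrightarrow> W i \<in> measurable M S" "i \<in> {1..n}"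
  shows "W i \<in> measurable (history M S W n) S"
proof -
  have "(\<lambda>\<omega>. \<lambda>i\<in>{1..n}. W i \<omega>) \<in> measurable (history M S W n) (PiM {1..n} (\<lambda>_. S))"
    unfolding history_def
    by (rule measurable_vimage_algebra1) (auto simp: space_PiM PiE_def Pi_iff intro!: measurable_space[OF assms(1)])
  then have "(\<lambda>\<omega>. (\<lambda>i\<in>{1..n}. W i \<omega>) i) \<in> measurable (history M S W n) S"
    by (rule measurable_compose) (rule measurable_component_singleton[OF assms(2)])
  then show ?thesis using assms(2) by simp
qed

text \<open>Minimality of the generated sigma-algebra. With \<open>N\<close> equal to
  \<open>M\<close> it gives a subalgebra, and with \<open>N\<close> a later history it gives
  monotonicity.\<close>

lemma sets_history_le:
  assumes "space N = space M" "\<And>i. i \<in> {1..n} \<Longrightarrow> W i \<in> measurable N S"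
  shows "sets (history M S W n) \<subseteq> sets N"
proof
  fix A assume A: "A \<in> sets (history M S W n)"
  have "(\<lambda>\<omega>. \<omega>) \<in> measurable N (history M S W n)"
    unfolding history_def
    by (rule measurable_vimage_algebra2) (use assms in \<open>auto intro!: measurable_restrict\<close>)
  from measurable_sets[OF this A] show "A \<in> sets N"
    using sets.sets_into_space[OF A] assms(1) by (simp add: Int_absorb2)
qed

lemma subalgebra_history:
  assumes "\<And>i. i \<in> {1..n} \<Longrightarrow> W i \<in> measurable M S"
  shows "subalgebra M (history M S W n)"
  using sets_history_le[of M M n W S] assms by (simp add: subalgebra_def)

lemma history_mono:
  assumes "\<And>i. i \<in> {1..k} \<Longrightarrow> W i \<in> measurable M S" "j \<le> k"
  shows "sets (history M S W j) \<subseteq> sets (history M S W k)"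
  by (rule sets_history_le) (use assms in \<open>auto intro!: measurable_history\<close>)

text \<open>Freezing: by independence the past and the next variable have a product law, so Fubini
  allows averaging over the new variable while the past is held fixed. This does the work of
  conditioning on the past.\<close>

lemma (in prob_space) expectation_history_next:
  fixes f :: "'a \<times> 'b \<Rightarrow> real"
  assumes ind: "indep_vars (\<lambda>_. S) W {1..}"
    and f: "f \<in> borel_measurable (history M S W n \<Otimes>\<^sub>M S)"
    and f_bdd: "\<And>\<omega> s. \<omega> \<in> space M \<Longrightarrow> s \<in> space S \<Longrightarrow> \<bar>f (\<omega>, s)\<bar> \<le> B"
  shows "expectation (\<lambda>\<omega>. f (\<omega>, W (Suc n) \<omega>)) = expectation (\<lambda>\<omega>. expectation (\<lambda>\<omega>'. f (\<omega>, W (Suc n) \<omega>')))"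
proof -
  let ?F = "history M S W n" and ?H = "\<lambda>\<omega>. \<lambda>i\<in>{1..n}. W i \<omega>" and ?P = "PiM {1..n} (\<lambda>_. S)"
  have W: "W i \<in> measurable M S" if "i \<ge> 1" for i
    using ind that by (auto simp: indep_vars_def2)
  have Wn: "W (Suc n) \<in> measurable M S" by (rule W) simp
  have sub: "subalgebra M ?F" by (rule subalgebra_history) (use W in auto)
  have idF: "(\<lambda>\<omega>. \<omega>) \<in> measurable M ?F"
    using sub by (intro measurableI) (auto simp: subalgebra_def)
  interpret A: prob_space "distr M ?F (\<lambda>\<omega>. \<omega>)" by (rule prob_space_distr[OF idF])
  interpret B: prob_space "distr M S (W (Suc n))" by (rule prob_space_distr[OF Wn])
  interpret AB: pair_prob_space "distr M ?F (\<lambda>\<omega>. \<omega>)" "distr M S (W (Suc n))" ..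
  let ?Q = "PiM {Suc n} (\<lambda>_. S)" and ?H' = "\<lambda>\<omega>. \<lambda>i\<in>{Suc n}. W i \<omega>"
  have "indep_var ?P ?H ?Q ?H'"
    by (rule indep_var_restrict[OF ind]) auto
  then have ind2: "indep_set (sets ?F) (sigma_sets (space M) {?H' -` A \<inter> space M | A. A \<in> sets ?Q})"
    by (simp add: indep_var_eq history_def sets_vimage_algebra)
  txt \<open>The past is encoded by the identity map into the coarser space \<open>?F\<close>. The constant \<open>indep_var\<close> forces
    both variables to have the same value type, so the product law is verified by hand.\<close>
  have eq: "distr M ?F (\<lambda>\<omega>. \<omega>) \<Otimes>\<^sub>M distr M S (W (Suc n)) = distr M (?F \<Otimes>\<^sub>M S) (\<lambda>\<omega>. (\<omega>, W (Suc n) \<omega>))"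
  proof (rule pair_measure_eqI)
    fix A B assume "A \<in> sets (distr M ?F (\<lambda>\<omega>. \<omega>))" "B \<in> sets (distr M S (W (Suc n)))"
    then have A: "A \<in> sets ?F" and B: "B \<in> sets S" by auto
    have AM: "A \<subseteq> space M" using sets.sets_into_space[OF A] by simp
    \<comment> \<open>Independence is available for vectors indexed by the singleton
      \<open>{Suc n}\<close>; \<open>?B\<close> turns an event about \<open>W (Suc n)\<close> into
      one about such a vector.\<close>
    let ?B = "(\<lambda>s. s (Suc n)) -` B \<inter> space ?Q"
    have "?B \<in> sets ?Q"
      by (rule measurable_sets[OF measurable_component_singleton[where M="\<lambda>_. S"] B]) simp
    moreover have "W (Suc n) -` B \<inter> space M = ?H' -` ?B \<inter> space M"
      using measurable_space[OF Wn] by (auto simp: space_PiM)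
    ultimately have "W (Suc n) -` B \<inter> space M \<in> sigma_sets (space M) {?H' -` A \<inter> space M | A. A \<in> sets ?Q}"
      by (intro sigma_sets.Basic) blast
    from indep_setD[OF ind2 A this]
    have "prob (A \<inter> (W (Suc n) -` B \<inter> space M)) = prob A * prob (W (Suc n) -` B \<inter> space M)" .
    moreover have "(\<lambda>\<omega>. (\<omega>, W (Suc n) \<omega>)) -` (A \<times> B) \<inter> space M = A \<inter> (W (Suc n) -` B \<inter> space M)"
      using AM by auto
    moreover have "(\<lambda>\<omega>. (\<omega>, W (Suc n) \<omega>)) \<in> measurable M (?F \<Otimes>\<^sub>M S)"
      using idF Wn by (rule measurable_Pair)
    moreover have "(\<lambda>\<omega>. \<omega>) -` A \<inter> space M = A" using AM by auto
    ultimately show "emeasure (distr M ?F (\<lambda>\<omega>. \<omega>)) A * emeasure (distr M S (W (Suc n))) B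
        = emeasure (distr M (?F \<Otimes>\<^sub>M S) (\<lambda>\<omega>. (\<omega>, W (Suc n) \<omega>))) (A \<times> B)"
      using A B idF Wn by (simp add: emeasure_distr emeasure_eq_measure ennreal_mult)
  qed (auto intro: A.sigma_finite_measure_axioms B.sigma_finite_measure_axioms cong: sets_pair_measure_cong)
  have fi: "integrable (distr M ?F (\<lambda>\<omega>. \<omega>) \<Otimes>\<^sub>M distr M S (W (Suc n))) f"
    by (rule AB.integrable_const_bound[of _ B])
      (use f f_bdd in \<open>auto simp: space_pair_measure intro!: AE_I2 cong: measurable_cong_sets\<close>)
  have "expectation (\<lambda>\<omega>. f (\<omega>, W (Suc n) \<omega>)) = integral\<^sup>L (distr M (?F \<Otimes>\<^sub>M S) (\<lambda>\<omega>. (\<omega>, W (Suc n) \<omega>))) f"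
    using idF Wn f by (subst integral_distr) auto
  also have "\<dots> = (\<integral>\<omega>. (\<integral>s. f (\<omega>, s) \<partial>distr M S (W (Suc n))) \<partial>distr M ?F (\<lambda>\<omega>. \<omega>))"
    unfolding eq[symmetric] using AB.integral_fst'[OF fi] by simp
  also have "\<dots> = expectation (\<lambda>\<omega>. \<integral>s. f (\<omega>, s) \<partial>distr M S (W (Suc n)))"
  proof (rule integral_distr[OF idF])
    have "(\<lambda>\<omega>. \<integral>s. f (\<omega>, s) \<partial>distr M S (W (Suc n))) \<in> borel_measurable (distr M ?F (\<lambda>\<omega>. \<omega>))"
      by (rule B.borel_measurable_lebesgue_integral) (use f in \<open>simp cong: measurable_cong_sets\<close>)
    then show "(\<lambda>\<omega>. \<integral>s. f (\<omega>, s) \<partial>distr M S (W (Suc n))) \<in> borel_measurable ?F" by simp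
  qed
  also have "\<dots> = expectation (\<lambda>\<omega>. expectation (\<lambda>\<omega>'. f (\<omega>, W (Suc n) \<omega>')))"
    by (intro Bochner_Integration.integral_cong refl integral_distr[OF Wn] measurable_Pair2[OF f]) simp
  finally show ?thesis .
qed

section \<open>Kernel smoothing of the drift\<close>

lemma rescaled_kernel:
  fixes K :: "real \<Rightarrow> real"
  assumes "integrable lborel K" "(\<integral>u. K u \<partial>lborel) = 1" "h > 0"
  shows "integrable lborel (\<lambda>u. 1 / h * K ((u - x) / h))" "(\<integral>u. 1 / h * K ((u - x) / h) \<partial>lborel) = 1"
proof -
  have e: "(\<lambda>v. K ((x + h * v - x) / h)) = K" using assms(3) by (simp add: fun_eq_iff)
  have i: "integrable lborel (\<lambda>u. K ((u - x) / h))"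
    using lborel_integrable_real_affine_iff[of h "\<lambda>u. K ((u - x) / h)" x] assms e by simp
  then show "integrable lborel (\<lambda>u. 1 / h * K ((u - x) / h))" by simp
  show "(\<integral>u. 1 / h * K ((u - x) / h) \<partial>lborel) = 1"
    using lborel_integral_real_affine[of h "\<lambda>u. K ((u - x) / h)" x] assms e by simp
qed

text \<open>The rescaled kernel averages \<open>\<phi>\<close> over the window of radius
  \<open>r * h\<close> around \<open>x\<close>, where \<open>\<phi>\<close> exceeds
  \<open>\<phi> x\<close> by at most the stated error.\<close>

lemma kernel_smoothing_le:
  fixes K \<phi> :: "real \<Rightarrow> real"
  assumes K: "integrable lborel K" "(\<integral>u. K u \<partial>lborel) = 1" and K0: "\<And>u. K u \<ge> 0"
    and h: "h > 0" and Kr: "\<And>v. K v \<noteq> 0 \<Longrightarrow> \<bar>v\<bar> \<le> r"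
    and [measurable]: "\<phi> \<in> borel_measurable borel" and B: "\<And>u. \<bar>\<phi> u\<bar> \<le> B"
    and L: "\<And>u. \<bar>\<phi> u - \<phi> x\<bar> \<le> L * \<bar>u - x\<bar> powr \<beta>" and b: "\<beta> > 0" and L0: "L \<ge> 0"
  shows "(\<integral>u. 1 / h * K ((u - x) / h) * \<phi> u \<partial>lborel) \<le> \<phi> x + L * (r * h) powr \<beta>"
proof -
  let ?k = "\<lambda>u. 1 / h * K ((u - x) / h)"
  note k = rescaled_kernel[OF K h, of x]
  have "(\<integral>u. ?k u * \<phi> u \<partial>lborel) \<le> (\<integral>u. ?k u * (\<phi> x + L * (r * h) powr \<beta>) \<partial>lborel)"
  proof (rule integral_mono)
    have "integrable lborel (\<lambda>u. ?k u * B)" using k(1) by (rule integrable_mult_left)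
    then show "integrable lborel (\<lambda>u. ?k u * \<phi> u)"
    proof (rule Bochner_Integration.integrable_bound)
      have [measurable]: "?k \<in> borel_measurable borel" using k(1) by (simp add: integrable_iff_bounded)
      show "(\<lambda>u. ?k u * \<phi> u) \<in> borel_measurable lborel" by measurable
      have "norm (?k u * \<phi> u) \<le> norm (?k u * B)" for u
        unfolding norm_mult using B[of u] by (intro mult_left_mono) auto
      then show "AE u in lborel. norm (?k u * \<phi> u) \<le> norm (?k u * B)" by simp
    qed
    show "integrable lborel (\<lambda>u. ?k u * (\<phi> x + L * (r * h) powr \<beta>))"
      using k(1) by (rule integrable_mult_left)
    show "?k u * \<phi> u \<le> ?k u * (\<phi> x + L * (r * h) powr \<beta>)" for u
    proof (cases "K ((u - x) / h) = 0")
      case False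
      from Kr[OF this] have "\<bar>u - x\<bar> \<le> r * h" using h by (simp add: abs_divide field_simps)
      then have "\<bar>u - x\<bar> powr \<beta> \<le> (r * h) powr \<beta>" using b by (intro powr_mono2) auto
      then have "\<phi> u \<le> \<phi> x + L * (r * h) powr \<beta>"
        using L[of u] mult_left_mono[OF _ L0, of "\<bar>u - x\<bar> powr \<beta>" "(r * h) powr \<beta>"] by linarith
      then show ?thesis using K0[of "(u - x) / h"] h by (intro mult_left_mono) auto
    qed simp
  qed
  also have "\<dots> = \<phi> x + L * (r * h) powr \<beta>"
    using k(2) by (simp only: integral_mult_left_zero mult_1)
  finally show ?thesis .
qed

text \<open>One factor of the square is bounded by \<open>B / h\<close> and the other integrates to
  one, so the order is \<open>1 / h\<close> and not \<open>1 / h\<^sup>2\<close>. This is what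
  matches the summability of \<open>\<gamma>\<^sup>2 / h\<close>.\<close>

lemma kernel_square_le:
  fixes K p :: "real \<Rightarrow> real"
  assumes K: "integrable lborel K" "(\<integral>u. K u \<partial>lborel) = 1" and K0: "\<And>u. K u \<ge> 0"
    and h: "h > 0" and KB: "\<And>u. K u \<le> B"
    and [measurable]: "p \<in> borel_measurable borel" and p0: "\<And>u. 0 \<le> p u" and pP: "\<And>u. p u \<le> P"
  shows "(\<integral>u. p u * (1 / h * K ((u - x) / h))\<^sup>2 \<partial>lborel) \<le> P * B / h"
proof -
  let ?k = "\<lambda>u. 1 / h * K ((u - x) / h)"
  note k = rescaled_kernel[OF K h, of x]
  have le: "p u * (?k u)\<^sup>2 \<le> (P * B / h) * ?k u" for u
  proof -
    have k0: "0 \<le> ?k u" using K0 h by simp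
    have "?k u \<le> B / h" using KB[of "(u - x) / h"] h by (simp add: divide_right_mono)
    then have "(?k u)\<^sup>2 \<le> (B / h) * ?k u"
      unfolding power2_eq_square using k0 by (rule mult_right_mono)
    then have "p u * (?k u)\<^sup>2 \<le> P * ((B / h) * ?k u)"
      using p0[of u] pP[of u] by (intro mult_mono) auto
    then show ?thesis by simp
  qed
  have i: "integrable lborel (\<lambda>u. (P * B / h) * ?k u)" by (rule integrable_mult_right[OF k(1)])
  have "(\<integral>u. p u * (?k u)\<^sup>2 \<partial>lborel) \<le> (\<integral>u. (P * B / h) * ?k u \<partial>lborel)"
  proof (rule integral_mono[OF _ i le])
    have [measurable]: "?k \<in> borel_measurable borel" using k(1) by (simp add: integrable_iff_bounded)
    show "integrable lborel (\<lambda>u. p u * (?k u)\<^sup>2)"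
    proof (rule Bochner_Integration.integrable_bound[OF i])
      show "(\<lambda>u. p u * (?k u)\<^sup>2) \<in> borel_measurable lborel" by measurable
      have "norm (p u * (?k u)\<^sup>2) \<le> norm ((P * B / h) * ?k u)" for u
        using order_trans[OF le[of u] abs_ge_self] p0[of u] unfolding real_norm_def by (subst abs_of_nonneg) auto
      then show "AE u in lborel. norm (p u * (?k u)\<^sup>2) \<le> norm ((P * B / h) * ?k u)" by simp
    qed
  qed
  also have "\<dots> = P * B / h" using k(2) by (simp only: integral_mult_right_zero mult_1_right)
  finally show ?thesis .
qed

text \<open>The unit vector from \<open>\<alpha>\<close> to \<open>y\<close> is minus a subgradient
  of the distance to \<open>y\<close> at \<open>\<alpha>\<close>. For \<open>y = \<alpha>\<close>
  the division by zero makes the left side 0, which is still admissible.\<close>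

lemma norm_subgradient:
  fixes y \<alpha> m :: "'h::real_inner"
  shows "inner (\<alpha> - m) ((1 / norm (y - \<alpha>)) *\<^sub>R (y - \<alpha>)) \<le> norm (y - m) - norm (y - \<alpha>)"
proof (cases "y = \<alpha>")
  case False
  have "inner (\<alpha> - m) (y - \<alpha>) = inner (y - m) (y - \<alpha>) - (norm (y - \<alpha>))\<^sup>2"
    by (simp add: power2_norm_eq_inner inner_diff_left inner_diff_right inner_commute)
  also have "\<dots> \<le> norm (y - m) * norm (y - \<alpha>) - (norm (y - \<alpha>))\<^sup>2"
    using norm_cauchy_schwarz[of "y - m" "y - \<alpha>"] by simp
  also have "\<dots> = (norm (y - m) - norm (y - \<alpha>)) * norm (y - \<alpha>)"
    by (simp add: power2_eq_square algebra_simps)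
  finally show ?thesis using False by (simp add: pos_divide_le_eq)
qed simp

lemma norm_normalized_le: "norm ((1 / norm v) *\<^sub>R (v :: 'h::real_normed_vector)) \<le> 1"
  by (cases "v = 0") auto

lemma integrable_normalized:
  fixes Q :: "'h::{real_inner,banach,second_countable_topology} measure"
  assumes "prob_space Q" and [measurable_cong]: "sets Q = sets borel"
  shows "integrable Q (\<lambda>y. (1 / norm (y - \<alpha>)) *\<^sub>R (y - \<alpha>))"
proof -
  interpret prob_space Q by fact
  show ?thesis by (rule integrable_const_bound[of _ 1]) (use norm_normalized_le in auto)
qed

lemma inner_cgm_Phi:
  assumes "prob_space (mu u)" "sets (mu u) = sets borel"
  shows "p u * (\<integral>y. inner v ((1 / norm (y - \<alpha>)) *\<^sub>R (y - \<alpha>)) \<partial>mu u) = - inner v (cgm_Phi p mu u \<alpha>)"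
  unfolding cgm_Phi_def using integrable_normalized[OF assms, of \<alpha>]
  by (subst integral_inner_right) auto

text \<open>Integrating the subgradient inequality bounds the drift by a gap of objective values, so
  the objective never has to be differentiated.\<close>

lemma inner_cgm_Phi_median_le:
  assumes Q: "prob_space (mu x)" "sets (mu x) = sets borel" and p: "p x \<ge> 0"
  shows "- inner (\<alpha> - m) (cgm_Phi p mu x \<alpha>)
    \<le> - (p x * ((\<integral>y. norm (y - \<alpha>) - norm y \<partial>mu x) - (\<integral>y. norm (y - m) - norm y \<partial>mu x)))"
proof -
  note i = integrable_norm_diff[OF Q]
  have "(\<integral>y. inner (\<alpha> - m) ((1 / norm (y - \<alpha>)) *\<^sub>R (y - \<alpha>)) \<partial>mu x)
     \<le> (\<integral>y. (norm (y - m) - norm y) - (norm (y - \<alpha>) - norm y) \<partial>mu x)"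
    using integrable_normalized[OF Q, of \<alpha>] norm_subgradient[of \<alpha> m]
    by (intro integral_mono integrable_inner_right Bochner_Integration.integrable_diff i) auto
  also have "\<dots> = (\<integral>y. norm (y - m) - norm y \<partial>mu x) - (\<integral>y. norm (y - \<alpha>) - norm y \<partial>mu x)"
    by (rule Bochner_Integration.integral_diff[OF i i])
  finally show ?thesis
    using mult_left_mono[OF _ p] inner_cgm_Phi[where mu=mu and u=x, OF Q, of p "\<alpha> - m" \<alpha>]
    by (fastforce simp: algebra_simps)
qed

text \<open>If the limit \<open>l\<close> were positive, \<open>V\<close> would eventually stay
  between \<open>l / 2\<close> and \<open>2 * l\<close>, and there \<open>\<gamma>\<close> is
  dominated by the summable \<open>\<gamma> * g / c\<close>.\<close>

lemma tendsto_zero_if_separated: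
  fixes V g \<gamma> :: "nat \<Rightarrow> real"
  assumes conv: "convergent V" and V0: "\<And>n. V n \<ge> 0"
    and s: "summable (\<lambda>n. \<gamma> n * g n)" and ns: "\<not> summable \<gamma>" and \<gamma>0: "\<And>n. \<gamma> n \<ge> 0"
    and sep: "\<And>l. l > 0 \<Longrightarrow> \<exists>c>0. \<forall>n. l / 2 \<le> V n \<longrightarrow> V n \<le> 2 * l \<longrightarrow> c \<le> g n"
  shows "V \<longlonglongrightarrow> 0"
proof -
  obtain l where l: "V \<longlonglongrightarrow> l" using conv by (auto simp: convergent_def)
  have "l = 0"
  proof (rule ccontr)
    assume "l \<noteq> 0"
    then have l0: "l > 0" using LIMSEQ_le_const[OF l, of 0] V0 by force
    obtain c where c: "c > 0" "\<And>n. l / 2 \<le> V n \<Longrightarrow> V n \<le> 2 * l \<Longrightarrow> c \<le> g n" using sep[OF l0] by blast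
    have "eventually (\<lambda>n. l / 2 < V n) sequentially" "eventually (\<lambda>n. V n < 2 * l) sequentially"
      using l0 by (intro order_tendstoD[OF l]; simp)+
    then have "eventually (\<lambda>n. norm (\<gamma> n) \<le> \<gamma> n * g n / c) sequentially"
    proof eventually_elim
      case (elim n)
      then have "\<gamma> n * c \<le> \<gamma> n * g n" using c \<gamma>0[of n] by (intro mult_left_mono) auto
      then show ?case using c(1) \<gamma>0[of n] by (simp add: field_simps)
    qed
    then have "summable \<gamma>" by (rule summable_comparison_test_ev) (rule summable_divide[OF s])
    with ns show False by simp
  qed
  with l show ?thesis by simp
qed

section \<open>Convergence of the recursive estimator\<close>

theorem theorem2p1:
  fixes M :: "'a measure"
    and X :: "nat \<Rightarrow> 'a \<Rightarrow> real"
    and Y :: "nat \<Rightarrow> 'a \<Rightarrow> 'h::{real_inner,banach,second_countable_topology}"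
    and p :: "real \<Rightarrow> real"
    and mu :: "real \<Rightarrow> 'h measure"
    and K :: "real \<Rightarrow> real"
    and \<gamma> h :: "nat \<Rightarrow> real"
    and \<beta> :: real
    and x :: real
    and z1 :: 'h
    and Z :: "nat \<Rightarrow> 'a \<Rightarrow> 'h"
    and m :: 'h
  assumes M: "prob_space M"
    \<comment> \<open>random variables and independence of the pairs (X_n, Y_n), n >= 1\<close>
    and X_meas: "\<And>n. n \<ge> 1 \<Longrightarrow> X n \<in> borel_measurable M"
    and Y_meas: "\<And>n. n \<ge> 1 \<Longrightarrow> Y n \<in> borel_measurable M"
    and indep: "prob_space.indep_vars M (\<lambda>_. borel \<Otimes>\<^sub>M borel) (\<lambda>n \<omega>. (X n \<omega>, Y n \<omega>)) {1..}"
    \<comment> \<open>p is a probability density, mu x the conditional law of Y given X = x\<close>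
    and p_meas: "p \<in> borel_measurable borel"
    and p_nonneg: "\<And>u. p u \<ge> 0"
    and mu_prob: "\<And>u. prob_space (mu u)"
    and mu_sets: "\<And>u. sets (mu u) = sets borel"
    and mu_kernel: "mu \<in> borel \<rightarrow>\<^sub>M subprob_algebra borel"
    and law: "\<And>n A B. n \<ge> 1 \<Longrightarrow> A \<in> sets borel \<Longrightarrow> B \<in> sets borel \<Longrightarrow>
        measure M {\<omega> \<in> space M. X n \<omega> \<in> A \<and> Y n \<omega> \<in> B}
          = (LINT u:A|lborel. p u * measure (mu u) B)"
    \<comment> \<open>(A1)\<close>
    and A1: "\<And>u v. u \<in> closure {t. p t > 0} \<Longrightarrow>
        \<exists>w. inner v w = 0 \<and> ext_variance (mu u) (\<lambda>y. inner w y) > 0"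
    \<comment> \<open>(A2)\<close>
    and A2_bdd: "bounded (range p)"
    and beta_pos: "\<beta> > 0"
    and A2: "\<exists>C2>0. \<forall>u u'. \<bar>p u - p u'\<bar> \<le> C2 * \<bar>u - u'\<bar> powr \<beta>"
    \<comment> \<open>(A3)\<close>
    and A3: "\<exists>C3>0. \<forall>u u' \<alpha>. norm (cgm_Phi p mu u \<alpha> - cgm_Phi p mu u' \<alpha>) \<le> C3 * \<bar>u - u'\<bar> powr \<beta>"
    \<comment> \<open>(A5)\<close>
    and K_meas: "K \<in> borel_measurable borel"
    and K_nonneg: "\<And>u. K u \<ge> 0"
    and K_bdd: "bounded (range K)"
    and K_supp: "compact (closure {u. K u \<noteq> 0})"
    and K_int: "integrable lborel K"
    and K_int1: "(\<integral>u. K u \<partial>lborel) = 1"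
    \<comment> \<open>step sizes and bandwidths\<close>
    and gamma_pos: "\<And>n. n \<ge> 1 \<Longrightarrow> \<gamma> n > 0"
    and h_pos: "\<And>n. n \<ge> 1 \<Longrightarrow> h n > 0"
    and sum_gamma: "\<not> summable (\<lambda>n. \<gamma> (Suc n))"
    and sum_gamma2: "summable (\<lambda>n. (\<gamma> (Suc n))\<^sup>2 / h (Suc n))"
    and sum_gamma_h: "summable (\<lambda>n. \<gamma> (Suc n) * h (Suc n) powr \<beta>)"
    \<comment> \<open>the point x and the recursive estimator\<close>
    and px: "p x > 0"
    and Z1: "\<And>\<omega>. \<omega> \<in> space M \<Longrightarrow> Z 1 \<omega> = z1"
    and Zrec: "\<And>n \<omega>. n \<ge> 1 \<Longrightarrow> \<omega> \<in> space M \<Longrightarrow>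
        Z (Suc n) \<omega> = Z n \<omega> + (\<gamma> n * (1 / h n) * K ((X (Suc n) \<omega> - x) / h n)
                                   / norm (Y (Suc n) \<omega> - Z n \<omega>)) *\<^sub>R (Y (Suc n) \<omega> - Z n \<omega>)"
    \<comment> \<open>m = m(x) the conditional geometric median (minimizer of G(., x))\<close>
    and m_min: "\<And>\<alpha>. cgm_G p mu m x \<le> cgm_G p mu \<alpha> x"
  shows "AE \<omega> in M. (\<lambda>n. norm (Z n \<omega> - m)) \<longlonglongrightarrow> 0"
proof -
  interpret prob_space M by (rule M)
  let ?S = "borel \<Otimes>\<^sub>M borel :: (real \<times> 'h) measure"
  define W where "W n \<omega> = (X n \<omega>, Y n \<omega>)" for n \<omega>
  \<comment> \<open>\<open>F n\<close> knows the pairs with indices 1 to \<open>n + 1\<close>, which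
    determine \<open>Z (Suc n)\<close>; the fresh pair used in step \<open>n\<close> has index
    \<open>n + 2\<close>.\<close>
  define F where "F n = history M ?S W (Suc n)" for n
  define \<kappa> where "\<kappa> n u = 1 / h (Suc n) * K ((u - x) / h (Suc n))" for n u
  define q where "q \<alpha> y = inner (\<alpha> - m) ((1 / norm (y - \<alpha>)) *\<^sub>R (y - \<alpha>))" for \<alpha> y :: 'h
  \<comment> \<open>The position is a fixed argument here. Only after freezing the past does
    \<open>drift n (Z (Suc n) \<omega>)\<close> become the conditional mean of the increment, so
    \<open>D\<close> below is centred and \<open>e\<close> holds its mean.\<close>
  define drift where "drift n \<alpha> = expectation (\<lambda>\<omega>. \<kappa> n (X (Suc (Suc n)) \<omega>) * q \<alpha> (Y (Suc (Suc n)) \<omega>))" for n \<alpha>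
  define V where "V n \<omega> = (norm (Z (Suc n) \<omega> - m))\<^sup>2" for n \<omega>
  define D where "D n \<omega> = 2 * \<gamma> (Suc n) *
    (\<kappa> n (X (Suc (Suc n)) \<omega>) * q (Z (Suc n) \<omega>) (Y (Suc (Suc n)) \<omega>) - drift n (Z (Suc n) \<omega>))" for n \<omega>
  define e where "e n \<omega> = 2 * \<gamma> (Suc n) * drift n (Z (Suc n) \<omega>)" for n \<omega>
  define R where "R n \<omega> = (norm ((\<gamma> (Suc n) * \<kappa> n (X (Suc (Suc n)) \<omega>) / norm (Y (Suc (Suc n)) \<omega> - Z (Suc n) \<omega>))
    *\<^sub>R (Y (Suc (Suc n)) \<omega> - Z (Suc n) \<omega>)))\<^sup>2" for n \<omega>
  \<comment> \<open>The objective \<open>cgm_G\<close> without its factor \<open>p x\<close>, which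
    is positive and so does not affect the minimizers.\<close>
  define G where "G \<alpha> = (\<integral>y. norm (y - \<alpha>) - norm y \<partial>mu x)" for \<alpha>

  \<comment> \<open>Constants, measurability and pointwise bounds\<close>
  obtain C3 where C3: "C3 > 0" "\<And>u u' \<alpha>. norm (cgm_Phi p mu u \<alpha> - cgm_Phi p mu u' \<alpha>) \<le> C3 * \<bar>u - u'\<bar> powr \<beta>"
    using A3 by blast
  obtain P where "\<And>u. \<bar>p u\<bar> \<le> P" using A2_bdd by (auto simp: bounded_iff)
  then have pP: "\<And>u. p u \<le> P" using abs_le_D1 by blast
  obtain KB where "\<And>u. \<bar>K u\<bar> \<le> KB" using K_bdd by (auto simp: bounded_iff)
  then have KB: "\<And>u. K u \<le> KB" using abs_le_D1 by blast
  obtain r where r: "r > 0" "\<And>v. K v \<noteq> 0 \<Longrightarrow> \<bar>v\<bar> \<le> r"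
  proof -
    obtain a where a: "\<And>v. v \<in> closure {u. K u \<noteq> 0} \<Longrightarrow> norm v \<le> a"
      using compact_imp_bounded[OF K_supp] by (auto simp: bounded_iff)
    have "\<bar>v\<bar> \<le> max a 1" if "K v \<noteq> 0" for v
      using a[OF subsetD[OF closure_subset], of v] that by simp
    then show thesis by (intro that[of "max a 1"]) auto
  qed
  have \<gamma>0: "0 < \<gamma> (Suc n)" and h0: "0 < h (Suc n)" for n using gamma_pos h_pos by auto
  have P0: "0 \<le> P" using p_nonneg pP order_trans by blast
  have KB0: "0 \<le> KB" using K_nonneg KB order_trans by blast

  have XM [measurable]: "X (Suc n) \<in> borel_measurable M" and YM [measurable]: "Y (Suc n) \<in> borel_measurable M" for n
    using X_meas Y_meas by auto
  have \<kappa>M [measurable]: "\<kappa> n \<in> borel_measurable borel" for n unfolding \<kappa>_def using K_meas by measurable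
  have qM [measurable]: "(\<lambda>z. q (fst z) (snd z)) \<in> borel_measurable (borel \<Otimes>\<^sub>M borel)"
    unfolding q_def by measurable
  have qM': "(\<lambda>\<omega>. q (f \<omega>) (g \<omega>)) \<in> borel_measurable N"
    if "f \<in> borel_measurable N" "g \<in> borel_measurable N" for f g and N :: "'b measure"
    using measurable_compose[OF measurable_Pair[OF that] qM] by simp
  have WM: "W n \<in> measurable M ?S" if "n \<ge> 1" for n
    unfolding W_def using X_meas[OF that] Y_meas[OF that] by measurable
  have ind: "indep_vars (\<lambda>_. ?S) W {1..}" using indep unfolding W_def[abs_def] .
  have \<kappa>0: "0 \<le> \<kappa> n u" for n u using K_nonneg h0[of n] by (simp add: \<kappa>_def)
  have \<kappa>B: "\<kappa> n u \<le> KB / h (Suc n)" for n u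
    using KB[of "(u - x) / h (Suc n)"] h0[of n] by (simp add: \<kappa>_def divide_right_mono)
  have q_le: "\<bar>q \<alpha> y\<bar> \<le> norm (\<alpha> - m)" for \<alpha> y
  proof -
    have "\<bar>q \<alpha> y\<bar> \<le> norm (\<alpha> - m) * norm ((1 / norm (y - \<alpha>)) *\<^sub>R (y - \<alpha>))"
      unfolding q_def by (rule Cauchy_Schwarz_ineq2)
    also have "\<dots> \<le> norm (\<alpha> - m)"
      using norm_normalized_le[of "y - \<alpha>"] by (intro mult_left_le) auto
    finally show ?thesis .
  qed
  have \<kappa>q_le: "\<bar>\<kappa> n u * q \<alpha> y\<bar> \<le> KB / h (Suc n) * norm (\<alpha> - m)" for n u \<alpha> y
    unfolding abs_mult using \<kappa>0[of n u] \<kappa>B[of n u] q_le[of \<alpha> y] by (intro mult_mono) auto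
  have joint: "expectation (\<lambda>\<omega>. f (X (Suc n) \<omega>) (Y (Suc n) \<omega>)) = (\<integral>u. p u * (\<integral>y. f u y \<partial>mu u) \<partial>lborel)"
    if f: "(\<lambda>z. f (fst z) (snd z)) \<in> borel_measurable ?S" "\<And>u y. \<bar>f u y\<bar> \<le> B" for n f and B :: real
    using expectation_joint_law[where X = "X (Suc n)" and Y = "Y (Suc n)" and mu = mu and p = p
        and f = "\<lambda>z. f (fst z) (snd z)" and B = B,
        OF M XM YM p_meas p_nonneg mu_prob mu_sets mu_kernel law[of "Suc n"] f(1) f(2)]
    by (simp only: fst_conv snd_conv le_add1 plus_1_eq_Suc[symmetric])

  \<comment> \<open>The drift at a frozen position and the second moment of the kernel
    weight\<close>
  have driftM: "drift n \<in> borel_measurable borel" for n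
    unfolding drift_def
  proof (rule borel_measurable_lebesgue_integral)
    have "(\<lambda>z. q (fst z) (Y (Suc (Suc n)) (snd z))) \<in> borel_measurable (borel \<Otimes>\<^sub>M M)"
      by (rule qM') measurable
    then show "(\<lambda>(\<alpha>, \<omega>). \<kappa> n (X (Suc (Suc n)) \<omega>) * q \<alpha> (Y (Suc (Suc n)) \<omega>)) \<in> borel_measurable (borel \<Otimes>\<^sub>M M)"
      unfolding case_prod_beta by measurable
  qed
  have \<kappa>qi: "integrable M (\<lambda>\<omega>. \<kappa> n (X (Suc (Suc n)) \<omega>) * q \<alpha> (Y (Suc (Suc n)) \<omega>))" for n \<alpha>
  proof (rule integrable_const_bound[of _ "KB / h (Suc n) * norm (\<alpha> - m)"])
    have "(\<lambda>\<omega>. q \<alpha> (Y (Suc (Suc n)) \<omega>)) \<in> borel_measurable M" by (rule qM') measurable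
    then show "(\<lambda>\<omega>. \<kappa> n (X (Suc (Suc n)) \<omega>) * q \<alpha> (Y (Suc (Suc n)) \<omega>)) \<in> borel_measurable M" by measurable
  qed (use \<kappa>q_le in auto)
  have drift_abs: "\<bar>drift n \<alpha>\<bar> \<le> KB / h (Suc n) * norm (\<alpha> - m)" for n \<alpha>
  proof -
    have "\<bar>drift n \<alpha>\<bar> \<le> expectation (\<lambda>\<omega>. \<bar>\<kappa> n (X (Suc (Suc n)) \<omega>) * q \<alpha> (Y (Suc (Suc n)) \<omega>)\<bar>)"
      unfolding drift_def by (rule integral_abs_bound)
    also have "\<dots> \<le> expectation (\<lambda>\<omega>. KB / h (Suc n) * norm (\<alpha> - m))"
      using \<kappa>qi[of n \<alpha>] \<kappa>q_le[of n _ \<alpha>] by (intro integral_mono) auto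
    finally show ?thesis by (simp add: prob_space)
  qed

  have drift_le: "drift n \<alpha> \<le> - (p x * (G \<alpha> - G m)) + norm (\<alpha> - m) * C3 * (r * h (Suc n)) powr \<beta>" for n \<alpha>
  proof -
    \<comment> \<open>The drift is the kernel average of this function of \<open>u\<close>, which
      equals \<open>- inner (\<alpha> - m) (cgm_Phi p mu u \<alpha>)\<close>. Thus (A3), being
      uniform in \<open>\<alpha>\<close>, makes it Hoelder continuous with a constant proportional
      to \<open>norm (\<alpha> - m)\<close>.\<close>
    define \<phi> where "\<phi> u = p u * (\<integral>y. q \<alpha> y \<partial>mu u)" for u
    have \<phi>: "\<phi> u = - inner (\<alpha> - m) (cgm_Phi p mu u \<alpha>)" for u
      unfolding \<phi>_def q_def by (rule inner_cgm_Phi[where mu=mu and u=u, OF mu_prob mu_sets])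
    have q1 [measurable]: "q \<alpha> \<in> borel_measurable borel" unfolding q_def[abs_def] by measurable
    have [measurable]: "(\<lambda>u. \<integral>y. q \<alpha> y \<partial>mu u) \<in> borel_measurable borel"
      by (rule measurable_compose[OF mu_kernel integral_measurable_subprob_algebra[OF q1]])
    have \<phi>M: "\<phi> \<in> borel_measurable borel" unfolding \<phi>_def using p_meas by measurable
    have \<phi>B: "\<bar>\<phi> u\<bar> \<le> P * norm (\<alpha> - m)" for u
    proof -
      interpret Q: prob_space "mu u" by (rule mu_prob)
      have [measurable_cong]: "sets (mu u) = sets borel" by (rule mu_sets)
      have "integrable (mu u) (q \<alpha>)"
        by (rule Q.integrable_const_bound[of _ "norm (\<alpha> - m)"]) (use q_le in auto)
      then have "(\<integral>y. \<bar>q \<alpha> y\<bar> \<partial>mu u) \<le> (\<integral>y. norm (\<alpha> - m) \<partial>mu u)"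
        using q_le by (intro integral_mono) auto
      then have "\<bar>\<integral>y. q \<alpha> y \<partial>mu u\<bar> \<le> norm (\<alpha> - m)"
        by (intro order_trans[OF integral_abs_bound]) (simp add: Q.prob_space)
      then show ?thesis unfolding \<phi>_def abs_mult using p_nonneg[of u] pP[of u] by (intro mult_mono) auto
    qed
    have \<phi>L: "\<bar>\<phi> u - \<phi> x\<bar> \<le> (norm (\<alpha> - m) * C3) * \<bar>u - x\<bar> powr \<beta>" for u
    proof -
      have "\<phi> u - \<phi> x = inner (\<alpha> - m) (cgm_Phi p mu x \<alpha> - cgm_Phi p mu u \<alpha>)"
        by (simp add: \<phi> inner_diff_right)
      also have "\<bar>\<dots>\<bar> \<le> norm (\<alpha> - m) * norm (cgm_Phi p mu x \<alpha> - cgm_Phi p mu u \<alpha>)"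
        by (rule Cauchy_Schwarz_ineq2)
      also have "\<dots> \<le> norm (\<alpha> - m) * (C3 * \<bar>u - x\<bar> powr \<beta>)"
        using C3(2)[of x \<alpha> u] by (intro mult_left_mono) (auto simp: abs_minus_commute)
      finally show ?thesis by simp
    qed
    have "drift n \<alpha> = (\<integral>u. p u * (\<integral>y. \<kappa> n u * q \<alpha> y \<partial>mu u) \<partial>lborel)"
      unfolding drift_def by (rule joint[of "\<lambda>u y. \<kappa> n u * q \<alpha> y"]) (measurable, rule \<kappa>q_le)
    also have "\<dots> = (\<integral>u. 1 / h (Suc n) * K ((u - x) / h (Suc n)) * \<phi> u \<partial>lborel)"
      by (intro Bochner_Integration.integral_cong) (simp_all add: \<phi>_def \<kappa>_def)
    also have "\<dots> \<le> \<phi> x + norm (\<alpha> - m) * C3 * (r * h (Suc n)) powr \<beta>"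
      using C3(1) by (intro kernel_smoothing_le[OF K_int K_int1 K_nonneg h0 r(2) \<phi>M \<phi>B \<phi>L beta_pos]) auto
    also have "\<phi> x \<le> - (p x * (G \<alpha> - G m))"
      unfolding \<phi> G_def by (rule inner_cgm_Phi_median_le[where mu=mu and x=x, OF mu_prob mu_sets p_nonneg])
    finally show ?thesis by simp
  qed

  have \<kappa>2: "expectation (\<lambda>\<omega>. (\<kappa> n (X (Suc (Suc n)) \<omega>))\<^sup>2) \<le> P * KB / h (Suc n)" for n
  proof -
    have "expectation (\<lambda>\<omega>. (\<kappa> n (X (Suc (Suc n)) \<omega>))\<^sup>2) = (\<integral>u. p u * (\<integral>y. (\<kappa> n u)\<^sup>2 \<partial>mu u) \<partial>lborel)"
    proof (rule joint[of "\<lambda>u y. (\<kappa> n u)\<^sup>2"])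
      show "\<bar>(\<kappa> n u)\<^sup>2\<bar> \<le> (KB / h (Suc n))\<^sup>2" for u
        using power_mono[OF \<kappa>B \<kappa>0, of n u 2] by simp
    qed measurable
    also have "\<dots> = (\<integral>u. p u * (1 / h (Suc n) * K ((u - x) / h (Suc n)))\<^sup>2 \<partial>lborel)"
      using prob_space.prob_space[OF mu_prob] by (simp add: \<kappa>_def)
    also have "\<dots> \<le> P * KB / h (Suc n)"
      by (rule kernel_square_le[OF K_int K_int1 K_nonneg h0 KB p_meas p_nonneg pP])
    finally show ?thesis .
  qed
  have \<kappa>2i: "integrable M (\<lambda>\<omega>. (\<kappa> n (X (Suc (Suc n)) \<omega>))\<^sup>2)" for n
    by (rule integrable_const_bound[of _ "(KB / h (Suc n))\<^sup>2"])
      (use power_mono[OF \<kappa>B \<kappa>0, of n _ 2] in auto)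

  \<comment> \<open>The filtration, adaptedness and boundedness of the iterates\<close>
  have subalg: "subalgebra M (F n)" for n
    unfolding F_def by (rule subalgebra_history) (use WM in auto)
  have mono: "sets (F i) \<subseteq> sets (F j)" if "i \<le> j" for i j
    unfolding F_def by (rule history_mono) (use WM that in auto)
  have XYF: "X (Suc i) \<in> borel_measurable (F n)" "Y (Suc i) \<in> borel_measurable (F n)" if "i \<le> n" for i n
  proof -
    have "W (Suc i) \<in> measurable (F n) ?S"
      unfolding F_def by (rule measurable_history) (use WM that in auto)
    from measurable_compose[OF this measurable_fst] measurable_compose[OF this measurable_snd]
    show "X (Suc i) \<in> borel_measurable (F n)" "Y (Suc i) \<in> borel_measurable (F n)"
      by (simp_all add: W_def)
  qed
  have spF [simp]: "space (F n) = space M" for n by (simp add: F_def)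
  have mF: "f \<in> borel_measurable (F j)" if "f \<in> borel_measurable (F i)" "i \<le> j"
    for i j and f :: "'a \<Rightarrow> 'c::topological_space"
    using that(1) mono[OF that(2)] by (auto simp: measurable_def)
  have mM: "f \<in> borel_measurable M" if "f \<in> borel_measurable (F i)" for i and f :: "'a \<Rightarrow> 'c::topological_space"
    using measurable_from_subalg[OF subalg that] .

  have Zstep: "Z (Suc (Suc n)) \<omega> = Z (Suc n) \<omega> + (\<gamma> (Suc n) * \<kappa> n (X (Suc (Suc n)) \<omega>) / norm (Y (Suc (Suc n)) \<omega> - Z (Suc n) \<omega>))
    *\<^sub>R (Y (Suc (Suc n)) \<omega> - Z (Suc n) \<omega>)" if "\<omega> \<in> space M" for n \<omega>
    using Zrec[of "Suc n", OF _ that] by (simp add: \<kappa>_def)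
  have ZF: "Z (Suc n) \<in> borel_measurable (F n)" for n
  proof (induction n)
    case 0
    have "Z (Suc 0) \<in> borel_measurable (F 0) \<longleftrightarrow> (\<lambda>_. z1) \<in> borel_measurable (F 0)"
      by (rule measurable_cong) (use Z1 in simp)
    then show ?case by simp
  next
    case (Suc n)
    have [measurable]: "Z (Suc n) \<in> borel_measurable (F (Suc n))" by (rule mF[OF Suc]) simp
    have [measurable]: "X (Suc (Suc n)) \<in> borel_measurable (F (Suc n))" "Y (Suc (Suc n)) \<in> borel_measurable (F (Suc n))"
      using XYF[of "Suc n" "Suc n"] by auto
    have "Z (Suc (Suc n)) \<in> borel_measurable (F (Suc n)) \<longleftrightarrow>
      (\<lambda>\<omega>. Z (Suc n) \<omega> + (\<gamma> (Suc n) * \<kappa> n (X (Suc (Suc n)) \<omega>) / norm (Y (Suc (Suc n)) \<omega> - Z (Suc n) \<omega>))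
        *\<^sub>R (Y (Suc (Suc n)) \<omega> - Z (Suc n) \<omega>)) \<in> borel_measurable (F (Suc n))"
      by (rule measurable_cong) (use Zstep in simp)
    moreover have "(\<lambda>\<omega>. Z (Suc n) \<omega> + (\<gamma> (Suc n) * \<kappa> n (X (Suc (Suc n)) \<omega>) / norm (Y (Suc (Suc n)) \<omega> - Z (Suc n) \<omega>))
        *\<^sub>R (Y (Suc (Suc n)) \<omega> - Z (Suc n) \<omega>)) \<in> borel_measurable (F (Suc n))" by measurable
    ultimately show ?case by simp
  qed
  have ZM [measurable]: "Z (Suc n) \<in> borel_measurable M" for n by (rule mM[OF ZF])
  have step_le: "norm ((\<gamma> (Suc n) * \<kappa> n u / norm v) *\<^sub>R v) \<le> \<gamma> (Suc n) * \<kappa> n u" for n u and v :: 'h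
    using mult_left_le[OF norm_normalized_le[of v], of "\<gamma> (Suc n) * \<kappa> n u"] \<gamma>0[of n] \<kappa>0[of n u]
    by (simp add: abs_mult)
  \<comment> \<open>The direction of each step has norm at most one, so step \<open>n\<close> has
    length at most \<open>\<gamma> (Suc n) * (KB / h (Suc n))\<close>. The bounds may grow without
    limit in \<open>n\<close>.\<close>
  have "\<exists>B. \<forall>\<omega>\<in>space M. norm (Z (Suc n) \<omega> - m) \<le> B" for n
  proof (induction n)
    case 0 then show ?case using Z1 by (intro exI[of _ "norm (z1 - m)"]) simp
  next
    case (Suc n)
    then obtain B where B: "\<And>\<omega>. \<omega> \<in> space M \<Longrightarrow> norm (Z (Suc n) \<omega> - m) \<le> B" by blast
    have "norm (Z (Suc (Suc n)) \<omega> - m) \<le> B + \<gamma> (Suc n) * (KB / h (Suc n))" if "\<omega> \<in> space M" for \<omega>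
    proof -
      let ?u = "X (Suc (Suc n)) \<omega>" and ?v = "Y (Suc (Suc n)) \<omega> - Z (Suc n) \<omega>"
      have "norm (Z (Suc (Suc n)) \<omega> - m) \<le> norm (Z (Suc n) \<omega> - m) + norm ((\<gamma> (Suc n) * \<kappa> n ?u / norm ?v) *\<^sub>R ?v)"
        using norm_triangle_ineq[of "Z (Suc n) \<omega> - m" "(\<gamma> (Suc n) * \<kappa> n ?u / norm ?v) *\<^sub>R ?v"]
        unfolding Zstep[OF that] by (simp add: algebra_simps)
      also have "\<dots> \<le> B + \<gamma> (Suc n) * (KB / h (Suc n))"
        using B[OF that] step_le[of n ?u ?v] mult_left_mono[OF \<kappa>B[of n ?u] less_imp_le[OF \<gamma>0[of n]]] by linarith
      finally show ?thesis .
    qed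
    then show ?case by blast
  qed
  then obtain BZ where BZ: "\<And>n \<omega>. \<omega> \<in> space M \<Longrightarrow> norm (Z (Suc n) \<omega> - m) \<le> BZ n" by metis

  have \<kappa>qZ: "\<bar>\<kappa> n u * q (Z (Suc n) \<omega>) y\<bar> \<le> KB / h (Suc n) * BZ n" if "\<omega> \<in> space M" for n u y \<omega>
    using order_trans[OF \<kappa>q_le mult_left_mono[OF BZ[OF that]]] KB0 h0[of n] by simp
  have driftZ: "\<bar>drift n (Z (Suc n) \<omega>)\<bar> \<le> KB / h (Suc n) * BZ n" if "\<omega> \<in> space M" for n \<omega>
    using order_trans[OF drift_abs mult_left_mono[OF BZ[OF that]]] KB0 h0[of n] by simp
  have driftF: "(\<lambda>\<omega>. drift n (Z (Suc n) \<omega>)) \<in> borel_measurable (F n)" for n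
    by (rule measurable_compose[OF ZF driftM])
  have D_bdd: "\<bar>D n \<omega>\<bar> \<le> 2 * \<gamma> (Suc n) * (2 * (KB / h (Suc n) * BZ n))" if "\<omega> \<in> space M" for n \<omega>
    unfolding D_def abs_mult
    using \<kappa>qZ[OF that, of n "X (Suc (Suc n)) \<omega>" "Y (Suc (Suc n)) \<omega>"] driftZ[OF that, of n] \<gamma>0[of n]
    by (intro mult_mono) (auto simp: abs_le_iff)
  have qF2: "(\<lambda>z. q (Z (Suc n) (fst z)) (snd (snd z))) \<in> borel_measurable (F n \<Otimes>\<^sub>M ?S)" for n
    by (rule qM') (use ZF in measurable)
  have next_step: "expectation (\<lambda>\<omega>. f \<omega> (X (Suc (Suc n)) \<omega>) (Y (Suc (Suc n)) \<omega>))
      = expectation (\<lambda>\<omega>. expectation (\<lambda>\<omega>'. f \<omega> (X (Suc (Suc n)) \<omega>') (Y (Suc (Suc n)) \<omega>')))"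
    if "(\<lambda>z. f (fst z) (fst (snd z)) (snd (snd z))) \<in> borel_measurable (F n \<Otimes>\<^sub>M ?S)"
      "\<And>\<omega> u y. \<omega> \<in> space M \<Longrightarrow> \<bar>f \<omega> u y\<bar> \<le> B" for f n and B :: real
    using expectation_history_next[OF ind that(1)[unfolded F_def], of B] that(2) by (simp add: W_def)

  \<comment> \<open>The martingale property of the centred increments\<close>
  interpret bounded_martingale_differences M F D
  proof unfold_locales
    show "subalgebra M (F n)" for n by (rule subalg)
    show "sets (F i) \<subseteq> sets (F j)" if "i \<le> j" for i j by (rule mono[OF that])
    show "D n \<in> borel_measurable (F (Suc n))" for n
    proof -
      have [measurable]: "X (Suc (Suc n)) \<in> borel_measurable (F (Suc n))" "Y (Suc (Suc n)) \<in> borel_measurable (F (Suc n))"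
        using XYF[of "Suc n" "Suc n"] by auto
      have [measurable]: "(\<lambda>\<omega>. q (Z (Suc n) \<omega>) (Y (Suc (Suc n)) \<omega>)) \<in> borel_measurable (F (Suc n))"
        by (rule qM'[OF mF[OF ZF]]) auto
      have [measurable]: "(\<lambda>\<omega>. drift n (Z (Suc n) \<omega>)) \<in> borel_measurable (F (Suc n))"
        by (rule mF[OF driftF]) simp
      show ?thesis unfolding D_def by measurable
    qed
    show "\<exists>B. \<forall>\<omega>\<in>space M. \<bar>D n \<omega>\<bar> \<le> B" for n using D_bdd by blast
  next
    fix n g and B :: real assume g: "g \<in> borel_measurable (F n)" and B: "\<And>\<omega>. \<omega> \<in> space M \<Longrightarrow> \<bar>g \<omega>\<bar> \<le> B"
    let ?f = "\<lambda>\<omega> u y. g \<omega> * (2 * \<gamma> (Suc n) * (\<kappa> n u * q (Z (Suc n) \<omega>) y - drift n (Z (Suc n) \<omega>)))"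
    have "expectation (\<lambda>\<omega>. g \<omega> * D n \<omega>)
      = expectation (\<lambda>\<omega>. expectation (\<lambda>\<omega>'. ?f \<omega> (X (Suc (Suc n)) \<omega>') (Y (Suc (Suc n)) \<omega>')))"
      unfolding D_def
    proof (rule next_step)
      note [measurable] = g driftF qF2
      show "(\<lambda>z. ?f (fst z) (fst (snd z)) (snd (snd z))) \<in> borel_measurable (F n \<Otimes>\<^sub>M ?S)" by measurable
      show "\<bar>?f \<omega> u y\<bar> \<le> B * (2 * \<gamma> (Suc n) * (2 * (KB / h (Suc n) * BZ n)))" if "\<omega> \<in> space M" for \<omega> u y
        unfolding abs_mult[of "g \<omega>"] abs_mult[of "2 * \<gamma> (Suc n)"]
        using B[OF that] \<kappa>qZ[OF that, of n u y] driftZ[OF that, of n] \<gamma>0[of n]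
        by (intro mult_mono) (auto simp: abs_le_iff)
    qed
    \<comment> \<open>With the past frozen, the inner mean of
      \<open>\<kappa> n u * q \<alpha> y\<close> is \<open>drift n \<alpha>\<close> by definition,
      so the bracket averages to zero.\<close>
    also have "\<dots> = expectation (\<lambda>\<omega>. 0)"
      using \<kappa>qi by (intro Bochner_Integration.integral_cong refl) (simp add: drift_def prob_space)
    finally show "expectation (\<lambda>\<omega>. g \<omega> * D n \<omega>) = 0" by simp
  qed

  \<comment> \<open>Moments of the three terms of the recursion\<close>
  have V_bdd: "\<bar>V n \<omega>\<bar> \<le> (BZ n)\<^sup>2" if "\<omega> \<in> space M" for n \<omega>
    unfolding V_def using power_mono[OF BZ[OF that], of n 2] by simp
  have V_int: "integrable M (V n)" for n
    by (rule integrable_bdd[OF _ V_bdd]) (unfold V_def, measurable)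
  have R_le: "R n \<omega> \<le> (\<gamma> (Suc n))\<^sup>2 * (\<kappa> n (X (Suc (Suc n)) \<omega>))\<^sup>2" for n \<omega>
    unfolding R_def power_mult_distrib[symmetric] by (intro power_mono step_le) simp
  have R_int: "integrable M (R n)" for n
  proof (rule Bochner_Integration.integrable_bound[OF integrable_mult_right[OF \<kappa>2i[of n], of "(\<gamma> (Suc n))\<^sup>2"]])
    show "R n \<in> borel_measurable M" unfolding R_def by measurable
    have "norm (R n \<omega>) \<le> norm ((\<gamma> (Suc n))\<^sup>2 * (\<kappa> n (X (Suc (Suc n)) \<omega>))\<^sup>2)" for \<omega>
      using R_le[of n \<omega>] by (simp add: R_def)
    then show "AE \<omega> in M. norm (R n \<omega>) \<le> norm ((\<gamma> (Suc n))\<^sup>2 * (\<kappa> n (X (Suc (Suc n)) \<omega>))\<^sup>2)" by simp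
  qed
  have R_E: "expectation (R n) \<le> P * KB * ((\<gamma> (Suc n))\<^sup>2 / h (Suc n))" for n
  proof -
    have "expectation (R n) \<le> expectation (\<lambda>\<omega>. (\<gamma> (Suc n))\<^sup>2 * (\<kappa> n (X (Suc (Suc n)) \<omega>))\<^sup>2)"
      by (intro integral_mono R_int integrable_mult_right \<kappa>2i R_le)
    also have "\<dots> \<le> (\<gamma> (Suc n))\<^sup>2 * (P * KB / h (Suc n))"
      using mult_left_mono[OF \<kappa>2[of n], of "(\<gamma> (Suc n))\<^sup>2"] by simp
    finally show ?thesis by (simp add: mult_ac)
  qed
  have D_E: "expectation (\<lambda>\<omega>. (D n \<omega>)\<^sup>2) \<le> 4 * P * KB * ((\<gamma> (Suc n))\<^sup>2 / h (Suc n)) * (1 + expectation (V n))" for n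
  proof -
    let ?k = "\<lambda>\<omega>. \<kappa> n (X (Suc (Suc n)) \<omega>)" and ?c = "4 * (\<gamma> (Suc n))\<^sup>2"
    let ?d = "\<lambda>\<omega>. drift n (Z (Suc n) \<omega>)"
    let ?kq = "\<lambda>\<omega>. ?k \<omega> * q (Z (Suc n) \<omega>) (Y (Suc (Suc n)) \<omega>)"
    \<comment> \<open>The variance is bounded by the second moment: adding this null term completes
      \<open>(D n \<omega>)\<^sup>2\<close> to
      \<open>?c * ((?kq \<omega>)\<^sup>2 - (?d \<omega>)\<^sup>2)\<close>, and the last square is
      dropped.\<close>
    have orth: "expectation (\<lambda>\<omega>. (4 * \<gamma> (Suc n) * ?d \<omega>) * D n \<omega>) = 0"
    proof (rule D_orthogonal)
      show "(\<lambda>\<omega>. 4 * \<gamma> (Suc n) * ?d \<omega>) \<in> borel_measurable (F n)" using driftF by measurable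
      show "\<bar>4 * \<gamma> (Suc n) * ?d \<omega>\<bar> \<le> 4 * \<gamma> (Suc n) * (KB / h (Suc n) * BZ n)" if "\<omega> \<in> space M" for \<omega>
        unfolding abs_mult using driftZ[OF that, of n] \<gamma>0[of n] by (intro mult_mono) auto
    qed
    have [measurable]: "?d \<in> borel_measurable M" by (rule mM[OF driftF])
    have [measurable]: "(\<lambda>\<omega>. q (Z (Suc n) \<omega>) (Y (Suc (Suc n)) \<omega>)) \<in> borel_measurable M"
      by (rule qM') measurable
    have [measurable]: "D n \<in> borel_measurable M" unfolding D_def by measurable
    have i1: "integrable M (\<lambda>\<omega>. (D n \<omega>)\<^sup>2)" by (rule integrable_square_bdd[OF _ D_bdd]) measurable
    have i2: "integrable M (\<lambda>\<omega>. (4 * \<gamma> (Suc n) * ?d \<omega>) * D n \<omega>)"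
    proof (rule integrable_bdd)
      show "\<bar>(4 * \<gamma> (Suc n) * ?d \<omega>) * D n \<omega>\<bar>
        \<le> 4 * \<gamma> (Suc n) * (KB / h (Suc n) * BZ n) * (2 * \<gamma> (Suc n) * (2 * (KB / h (Suc n) * BZ n)))"
        if "\<omega> \<in> space M" for \<omega>
        using driftZ[OF that, of n] D_bdd[OF that, of n] \<gamma>0[of n]
        unfolding abs_mult[of "4 * \<gamma> (Suc n) * ?d \<omega>"] abs_mult[of "4 * \<gamma> (Suc n)"] by (intro mult_mono) auto
    qed measurable
    have i3: "integrable M (\<lambda>\<omega>. (?kq \<omega>)\<^sup>2)" by (rule integrable_square_bdd[OF _ \<kappa>qZ]) measurable
    have "expectation (\<lambda>\<omega>. (D n \<omega>)\<^sup>2) = expectation (\<lambda>\<omega>. (D n \<omega>)\<^sup>2 + (4 * \<gamma> (Suc n) * ?d \<omega>) * D n \<omega>)"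
      using orth i1 i2 by simp
    also have "\<dots> \<le> expectation (\<lambda>\<omega>. ?c * (?kq \<omega>)\<^sup>2)"
    proof (rule integral_mono)
      show "(D n \<omega>)\<^sup>2 + (4 * \<gamma> (Suc n) * ?d \<omega>) * D n \<omega> \<le> ?c * (?kq \<omega>)\<^sup>2" for \<omega>
      proof -
        have "?c * (?kq \<omega>)\<^sup>2 - ((D n \<omega>)\<^sup>2 + (4 * \<gamma> (Suc n) * ?d \<omega>) * D n \<omega>) = ?c * (?d \<omega>)\<^sup>2"
          unfolding D_def by (simp add: power2_eq_square algebra_simps)
        moreover have "0 \<le> ?c * (?d \<omega>)\<^sup>2" by simp
        ultimately show ?thesis by linarith
      qed
    qed (use i1 i2 i3 in auto)
    also have "\<dots> = ?c * expectation (\<lambda>\<omega>. (?kq \<omega>)\<^sup>2)" by simp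
    finally have le: "expectation (\<lambda>\<omega>. (D n \<omega>)\<^sup>2) \<le> ?c * expectation (\<lambda>\<omega>. (?kq \<omega>)\<^sup>2)" .
    \<comment> \<open>Once the past is frozen and the square of \<open>q\<close> is bounded by
      \<open>V n\<close>, the kernel weight is the only random factor left; its second moment
      supplies \<open>P * KB / h (Suc n)\<close>.\<close>
    have "expectation (\<lambda>\<omega>. (?kq \<omega>)\<^sup>2)
      = expectation (\<lambda>\<omega>. expectation (\<lambda>\<omega>'. (?k \<omega>' * q (Z (Suc n) \<omega>) (Y (Suc (Suc n)) \<omega>'))\<^sup>2))"
    proof (rule next_step[of "\<lambda>\<omega> u y. (\<kappa> n u * q (Z (Suc n) \<omega>) y)\<^sup>2"])
      note [measurable] = qF2
      show "(\<lambda>z. (\<kappa> n (fst (snd z)) * q (Z (Suc n) (fst z)) (snd (snd z)))\<^sup>2) \<in> borel_measurable (F n \<Otimes>\<^sub>M ?S)"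
        by measurable
      show "\<bar>(\<kappa> n u * q (Z (Suc n) \<omega>) y)\<^sup>2\<bar> \<le> (KB / h (Suc n) * BZ n)\<^sup>2" if "\<omega> \<in> space M" for \<omega> u y
        using power_mono[OF \<kappa>qZ[OF that, of n u y], of 2] by simp
    qed
    also have "\<dots> \<le> expectation (\<lambda>\<omega>. (P * KB / h (Suc n)) * V n \<omega>)"
    \<comment> \<open>This rule asks for integrability of the larger side only, so the inner
      expectation need not be shown measurable in \<open>\<omega>\<close>.\<close>
    proof (rule integral_mono')
      show "integrable M (\<lambda>\<omega>. (P * KB / h (Suc n)) * V n \<omega>)" using V_int by auto
      show "expectation (\<lambda>\<omega>'. (?k \<omega>' * q (Z (Suc n) \<omega>) (Y (Suc (Suc n)) \<omega>'))\<^sup>2) \<le> (P * KB / h (Suc n)) * V n \<omega>" for \<omega>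
      proof -
        have "expectation (\<lambda>\<omega>'. (?k \<omega>' * q (Z (Suc n) \<omega>) (Y (Suc (Suc n)) \<omega>'))\<^sup>2) \<le> expectation (\<lambda>\<omega>'. (?k \<omega>')\<^sup>2 * V n \<omega>)"
        proof (rule integral_mono')
          show "integrable M (\<lambda>\<omega>'. (?k \<omega>')\<^sup>2 * V n \<omega>)" using \<kappa>2i by auto
          show "(?k \<omega>' * q (Z (Suc n) \<omega>) (Y (Suc (Suc n)) \<omega>'))\<^sup>2 \<le> (?k \<omega>')\<^sup>2 * V n \<omega>" for \<omega>'
            using power_mono[OF q_le abs_ge_zero, of "Z (Suc n) \<omega>" "Y (Suc (Suc n)) \<omega>'" 2]
            by (simp add: V_def power_mult_distrib mult_left_mono)
        qed (simp add: V_def)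
        also have "\<dots> \<le> (P * KB / h (Suc n)) * V n \<omega>"
          using mult_right_mono[OF \<kappa>2[of n], of "V n \<omega>"] by (simp add: V_def)
        finally show ?thesis .
      qed
      show "0 \<le> (P * KB / h (Suc n)) * V n \<omega>" for \<omega>
        using P0 KB0 h0[of n] by (simp add: V_def)
    qed
    also have "\<dots> = (P * KB / h (Suc n)) * expectation (V n)" by simp
    also have "\<dots> \<le> (P * KB / h (Suc n)) * (1 + expectation (V n))"
      using P0 KB0 h0[of n] by (intro mult_left_mono) auto
    finally have "?c * expectation (\<lambda>\<omega>. (?kq \<omega>)\<^sup>2) \<le> ?c * ((P * KB / h (Suc n)) * (1 + expectation (V n)))"
      by (rule mult_left_mono) simp
    with le show ?thesis by (simp add: mult_ac)
  qed

  \<comment> \<open>Application of the Robbins-Siegmund lemma and conclusion\<close>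
  have G_ge: "G m \<le> G \<alpha>" for \<alpha>
    using m_min[of \<alpha>] px by (simp add: cgm_G_def G_def)
  \<comment> \<open>The smoothing error of the drift carries the factor
    \<open>norm (\<alpha> - m)\<close>, and \<open>e\<close> a factor 2. The inequality
    \<open>2 * t \<le> 1 + t\<^sup>2\<close> turns their product into \<open>1 + V n\<close>, so no
    2 remains here.\<close>
  define a where "a n = C3 * r powr \<beta> * (\<gamma> (Suc n) * h (Suc n) powr \<beta>)" for n
  have AE: "AE \<omega> in M. convergent (\<lambda>n. V n \<omega>) \<and> summable (\<lambda>n. 2 * \<gamma> (Suc n) * (p x * (G (Z (Suc n) \<omega>) - G m)))"
  proof (rule Robbins_Siegmund[where R = R and e = e and a = a, OF V_int _ R_int _ R_E _ _ _ D_E])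
    show "0 \<le> V n \<omega>" "0 \<le> R n \<omega>" for n \<omega> by (simp_all add: V_def R_def)
    show "0 \<le> 2 * \<gamma> (Suc n) * (p x * (G (Z (Suc n) \<omega>) - G m))" for n \<omega>
      using \<gamma>0[of n] px G_ge by simp
    show "V (Suc n) \<omega> = V n \<omega> + D n \<omega> + R n \<omega> + e n \<omega>" if "\<omega> \<in> space M" for n \<omega>
    proof -
      let ?z = "Z (Suc n) \<omega> - m" and ?v = "Y (Suc (Suc n)) \<omega> - Z (Suc n) \<omega>"
      let ?s = "(\<gamma> (Suc n) * \<kappa> n (X (Suc (Suc n)) \<omega>) / norm ?v) *\<^sub>R ?v"
      have "V (Suc n) \<omega> = (norm (?z + ?s))\<^sup>2"
        unfolding V_def Zstep[OF that] by (simp add: algebra_simps)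
      also have "\<dots> = (norm ?z)\<^sup>2 + 2 * inner ?z ?s + (norm ?s)\<^sup>2"
        by (simp only: power2_norm_eq_inner inner_add inner_commute[of ?s ?z] mult_2 add_ac)
      also have "2 * inner ?z ?s = D n \<omega> + e n \<omega>"
      proof -
        have "inner ?z ?s = \<gamma> (Suc n) * \<kappa> n (X (Suc (Suc n)) \<omega>) * q (Z (Suc n) \<omega>) (Y (Suc (Suc n)) \<omega>)"
          by (simp add: q_def)
        then show ?thesis by (simp add: D_def e_def algebra_simps)
      qed
      finally show ?thesis by (simp add: V_def R_def)
    qed
    show "e n \<omega> \<le> a n * (1 + V n \<omega>) - 2 * \<gamma> (Suc n) * (p x * (G (Z (Suc n) \<omega>) - G m))" for n \<omega>
    proof -
      let ?\<alpha> = "Z (Suc n) \<omega>"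
      have "e n \<omega> \<le> 2 * \<gamma> (Suc n) * (- (p x * (G ?\<alpha> - G m)) + norm (?\<alpha> - m) * C3 * (r * h (Suc n)) powr \<beta>)"
        unfolding e_def using \<gamma>0[of n] by (intro mult_left_mono drift_le) auto
      also have "\<dots> = a n * (2 * norm (?\<alpha> - m)) - 2 * \<gamma> (Suc n) * (p x * (G ?\<alpha> - G m))"
        using r(1) h0[of n] by (simp add: a_def powr_mult algebra_simps)
      also have "a n * (2 * norm (?\<alpha> - m)) \<le> a n * (1 + V n \<omega>)"
        using sum_squares_bound[of 1 "norm (?\<alpha> - m)"] C3(1) \<gamma>0[of n]
        by (intro mult_left_mono) (auto simp: V_def a_def)
      finally show ?thesis by simp
    qed
    show "0 \<le> a n" for n using C3(1) \<gamma>0[of n] by (simp add: a_def)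
    show "0 \<le> 4 * P * KB * ((\<gamma> (Suc n))\<^sup>2 / h (Suc n))" for n using P0 KB0 h0[of n] by simp
    show "summable a" unfolding a_def[abs_def] by (rule summable_mult[OF sum_gamma_h])
    show "summable (\<lambda>n. P * KB * ((\<gamma> (Suc n))\<^sup>2 / h (Suc n)))"
      "summable (\<lambda>n. 4 * P * KB * ((\<gamma> (Suc n))\<^sup>2 / h (Suc n)))"
      by (rule summable_mult[OF sum_gamma2])+
  qed
  have nondeg: "\<exists>w. inner v w = 0 \<and> ext_variance (mu x) (\<lambda>y. inner w y) > 0" for v
    by (rule A1, rule subsetD[OF closure_subset]) (simp add: px)
  show ?thesis using AE
  proof eventually_elim
    fix \<omega> assume *: "convergent (\<lambda>n. V n \<omega>) \<and> summable (\<lambda>n. 2 * \<gamma> (Suc n) * (p x * (G (Z (Suc n) \<omega>) - G m)))"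
    have "(\<lambda>n. V n \<omega>) \<longlonglongrightarrow> 0"
    proof (rule tendsto_zero_if_separated[where \<gamma> = "\<lambda>n. 2 * \<gamma> (Suc n)"])
      show "\<not> summable (\<lambda>n. 2 * \<gamma> (Suc n))"
        using sum_gamma summable_mult[of "\<lambda>n. 2 * \<gamma> (Suc n)" "1/2"] by auto
      fix l :: real assume l: "l > 0"
      \<comment> \<open>\<open>V\<close> is a squared distance, so the band from
        \<open>l / 2\<close> to \<open>2 * l\<close> is an annulus with these square roots as
        radii.\<close>
      obtain c where c: "c > 0" "\<And>\<alpha>. sqrt (l / 2) \<le> norm (\<alpha> - m) \<Longrightarrow> norm (\<alpha> - m) \<le> sqrt (2 * l) \<Longrightarrow> c \<le> G \<alpha> - G m"
      proof -
        have "sqrt (l / 2) > 0" using l by simp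
        from median_well_separated[where Q = "mu x", OF mu_prob mu_sets nondeg G_ge[unfolded G_def] this, of "sqrt (2 * l)"]
        show thesis using that unfolding G_def by blast
      qed
      show "\<exists>c>0. \<forall>n. l / 2 \<le> V n \<omega> \<longrightarrow> V n \<omega> \<le> 2 * l \<longrightarrow> c \<le> p x * (G (Z (Suc n) \<omega>) - G m)"
      proof (intro exI[of _ "p x * c"] conjI allI impI)
        fix n assume "l / 2 \<le> V n \<omega>" "V n \<omega> \<le> 2 * l"
        then have "c \<le> G (Z (Suc n) \<omega>) - G m"
          by (intro c(2)) (simp_all add: V_def real_le_lsqrt real_le_rsqrt real_sqrt_le_iff)
        then show "p x * c \<le> p x * (G (Z (Suc n) \<omega>) - G m)" using px by simp
      qed (use px c in simp)
    qed (use * \<gamma>0 in \<open>auto simp: V_def less_imp_le\<close>)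
    then have "(\<lambda>n. sqrt (V n \<omega>)) \<longlonglongrightarrow> sqrt 0" by (rule tendsto_real_sqrt)
    then have "(\<lambda>n. norm (Z (Suc n) \<omega> - m)) \<longlonglongrightarrow> 0" by (simp add: V_def)
    then show "(\<lambda>n. norm (Z n \<omega> - m)) \<longlonglongrightarrow> 0" by (rule LIMSEQ_imp_Suc)
  qed
qed

end
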